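(* Let $A\in\mathbb{R}^{n\times n}$, $C\in\mathbb{R}^{m\times n}$ with $(C,A)$ observable, and consider the leader $\dot x_0(t)=Ax_0(t)$, $y_0(t)=Cx_0(t)$, $t\ge0$, together with $N$ followers communicating over the switching graph $\bar{\mathcal G}_{\sigma(t)}$ described in the context. Assume (i) the subgraph $\mathcal G_{\sigma(t)}$ is undirected for all $t\ge0$, and (ii) there exist $T_{\mathrm c}>0$ and a subsequence $\{t_{j_k}\}$ of the switching instants with $t_{j_0}=0$ and $t_{j_{k+1}}-t_{j_k}\le T_{\mathrm c}$ for all $k$, such that for every $k$ every node $i\in\{1,\dots,N\}$ is reachable from node $0$ in the union graph $\bigcup_{t_j\in[t_{j_k},t_{j_{k+1}})}\bar{\mathcal G}_{\sigma(t_j)}$. Let $\delta\in(0,1)$ satisfy $\left\|\prod_{r=j_k}^{j_{k+1}-1}P_{\sigma(t_r)}\right\|\le\delta$ for all $k=0,1,2,\dots$. If $\lambda_{\max}(A)<-\ln\delta/T_{\mathrm c}$, then there exists $L\in\mathbb{R}^{n\times m}$ such that, for the distributed observer $$\dot\eta_i(t)=A\eta_i(t)+LC\sum_{j=0}^N a_{ij}(t)\,(\eta_j(t)-\eta_i(t)),\quad i=1,\dots,N,\qquad \eta_0(t)=x_0(t),$$ for all initial conditions $x_0(0),\eta_1(0),\dots,\eta_N(0)\in\mathbb{R}^n$ the solutions exist on $[0,\infty)$ and $\eta_i(t)-x_0(t)\to0$ exponentially as $t\to\infty$ for every $i=1,\dots,N$.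
   Context: A piecewise constant switching signal is a map $\sigma:[0,\infty)\to\mathcal P=\{1,\dots,n_0\}$ for which there are switching instants $0=t_0<t_1<\cdots$ and a dwell time $\tau>0$ with $t_{j+1}-t_j\ge\tau$, such that $\sigma$ is constant on each $[t_j,t_{j+1})$. For each $p\in\mathcal P$, $\bar{\mathcal G}_p$ is a graph on node set $\{0,1,\dots,N\}$ with edge set $\bar{\mathcal E}_p$ of ordered pairs $(j,i)$, $j\ne i$. $a_{ij}(t)=1$ if $(j,i)\in\bar{\mathcal E}_{\sigma(t)}$, else $0$. $\mathcal G_{\sigma(t)}$ is the subgraph on $\{1,\dots,N\}$ with the edges of $\bar{\mathcal E}_{\sigma(t)}$ among these nodes; undirected means $(i,j)$ is an edge iff $(j,i)$ is. Its Laplacian $\mathcal L_{\sigma(t)}$ has $l_{ii}=\sum_{j=1}^Na_{ij}(t)$, $l_{ij}=-a_{ij}(t)$ for $i\ne j$. $\Delta_{\sigma(t)}=\mathrm{diag}(a_{10}(t),\dots,a_{N0}(t))$, $\mathcal H_{\sigma(t)}=\mathcal L_{\sigma(t)}+\Delta_{\sigma(t)}$, and $P_{\sigma(t)}$ is the orthogonal projection of $\mathbb{R}^N$ onto $\ker\mathcal H_{\sigma(t)}$ (zero if the kernel is trivial). Node $i$ is reachable from $0$ if there are edges $(0,i_2),(i_2,i_3),\dots,(i_s,i)$; a union graph has the union of the edge sets. $\prod_{r=m}^n\Xi_r=\Xi_n\cdots\Xi_m$. $\|\cdot\|$ is the induced Euclidean norm; $\lambda_{\max}(A)$ is the largest real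 part of eigenvalues of $A$. *)

theory Defs
  imports "HOL-Analysis.Analysis"
begin

text \<open>Nodes of the graph: the leader (node 0) is None, follower i is Some i.\<close>

definition observable :: "real^'n^'m \<Rightarrow> real^'n^'n \<Rightarrow> bool" where
  "observable C A \<longleftrightarrow>
     (\<forall>x::real^'n. (\<forall>k<CARD('n). C *v (((\<lambda>y. A *v y) ^^ k) x) = 0) \<longrightarrow> x = 0)"

definition cmat :: "real^'n^'n \<Rightarrow> complex^'n^'n" where
  "cmat A = (\<chi> i j. complex_of_real (A $ i $ j))"

definition eigenvalues :: "real^'n^'n \<Rightarrow> complex set" where
  "eigenvalues A = {z. \<exists>v::complex^'n. v \<noteq> 0 \<and> cmat A *v v = z *s v}"

definition lambda_max :: "real^'n^'n \<Rightarrow> real" where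
  "lambda_max A = Max (Re ` eigenvalues A)"

definition adj :: "('N option \<times> 'N option) set \<Rightarrow> 'N option \<Rightarrow> 'N option \<Rightarrow> real" where
  "adj E i j = (if (j, i) \<in> E then 1 else 0)"

definition laplacian :: "('N::finite option \<times> 'N option) set \<Rightarrow> real^'N^'N" where
  "laplacian E = (\<chi> i j. (if i = j then (\<Sum>k\<in>UNIV. adj E (Some i) (Some k)) else 0)
                        - (if i \<noteq> j then adj E (Some i) (Some j) else 0))"

definition Delta :: "('N::finite option \<times> 'N option) set \<Rightarrow> real^'N^'N" where
  "Delta E = (\<chi> i j. if i = j then adj E (Some i) None else 0)"

definition Hmat :: "('N::finite option \<times> 'N option) set \<Rightarrow> real^'N^'N" where
  "Hmat E = laplacian E + Delta E"

definition orth_proj :: "(real^'N) set \<Rightarrow> real^'N^'N" where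
  "orth_proj S = (THE P. \<forall>x. P *v x \<in> S \<and> (\<forall>y\<in>S. (x - P *v x) \<bullet> y = 0))"

definition Pker :: "('N::finite option \<times> 'N option) set \<Rightarrow> real^'N^'N" where
  "Pker E = orth_proj {x. Hmat E *v x = 0}"

definition ordprod :: "(nat \<Rightarrow> real^'N^'N) \<Rightarrow> nat \<Rightarrow> nat \<Rightarrow> real^'N^'N" where
  "ordprod f m n = foldl (\<lambda>acc r. f r ** acc) (mat 1) [m..<n]"

definition induced_norm :: "real^'N^'N \<Rightarrow> real" where
  "induced_norm M = onorm (\<lambda>x. M *v x)"

text \<open>Solutions: continuous on [0,oo), with right derivatives for all t >= 0
  (the switching signal is right-continuous piecewise constant).\<close>
definition is_solution ::
  "real^'n^'n \<Rightarrow> real^'n^'n \<Rightarrow> (real \<Rightarrow> ('N::finite option \<times> 'N option) set)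
    \<Rightarrow> (real \<Rightarrow> real^'n) \<Rightarrow> ('N \<Rightarrow> real \<Rightarrow> real^'n) \<Rightarrow> bool" where
  "is_solution A K G x0 eta \<longleftrightarrow>
     continuous_on {0..} x0 \<and> (\<forall>i. continuous_on {0..} (eta i)) \<and>
     (\<forall>t\<ge>0. (x0 has_vector_derivative (A *v x0 t)) (at t within {t..})) \<and>
     (\<forall>i. \<forall>t\<ge>0. (eta i has_vector_derivative
         (A *v eta i t + K *v (\<Sum>j\<in>UNIV. adj (G t) (Some i) j *\<^sub>R
             ((case j of None \<Rightarrow> x0 t | Some j' \<Rightarrow> eta j' t) - eta i t))))
         (at t within {t..}))"

end

theory Submission
  imports Defs "HOL-Computational_Algebra.Fundamental_Theorem_Algebra"
begin

text \<open>
  Stack the errors \<open>\<eta>\<^sub>i - x\<^sub>0\<close> as the rows of an \<open>N \<times> n\<close> matrix \<open>e\<close>. Then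
  \<open>e' = e A\<^sup>T - H e (L C)\<^sup>T\<close>, with \<open>H\<close> symmetric, positive semidefinite and constant between switches.
  On the kernel of \<open>H\<close> the error evolves freely by \<open>exp (A t)\<close>; on the orthogonal complement a
  high gain makes it arbitrarily small within one dwell time. Hence, up to a small error, the transition
  over \<open>[t\<^sub>j, t\<^sub>j\<^sub>+\<^sub>1)\<close> is \<open>e \<mapsto> P\<^sub>j e exp (A (t\<^sub>j\<^sub>+\<^sub>1 - t\<^sub>j))\<^sup>T\<close>, and over \<open>K\<close> cycles it has
  norm at most \<open>\<delta>\<^sup>K M exp (\<mu> K T\<^sub>c)\<close> plus a small error, where \<open>\<mu> > \<lambda>\<^sub>m\<^sub>a\<^sub>x A\<close>. For \<open>K\<close> large and then the
  gain large, this is at most \<open>1/2\<close>.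

  The gain is \<open>L = \<kappa> W\<^sup>-\<^sup>1 C\<^sup>T\<close>, where \<open>W\<close> solves \<open>A\<^sup>T W + W A + 2 \<gamma> W = C\<^sup>T C\<close>. The quadratic form
  of \<open>W\<close> decays at rate \<open>2 \<gamma>\<close> on the complement of the kernel. This beats the peaking because, by
  observability, the smallest eigenvalue of \<open>W\<close> is not exponentially small in \<open>\<gamma>\<close>.
\<close>

section \<open>Linear differential equations with right derivatives\<close>

text \<open>One gain has to serve every graph, although the matrices \<open>H\<close> of different
  graphs need not share a kernel or an eigenbasis. No modal decomposition is used for this reason:
  the form \<open>trace (e W e^T)\<close> works for all graphs at once. Since
  \<open>W L C = \<kappa> C^T C\<close>, the coupling enters its derivative only through
  \<open>Y = e C^T\<close>, as \<open>- 2 \<kappa> (Y . H Y)\<close>, while the Lyapunov equation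
  contributes \<open>+ |Y|^2\<close>. Off the kernel \<open>Y . H Y \<ge> l |Y|^2\<close>, with one
  \<open>l\<close> for the finitely many graphs, so \<open>\<kappa> = 1 / (2 l)\<close> suffices
  whatever \<open>\<gamma>\<close> is. Only \<open>\<gamma>\<close> is pushed to infinity. Over a
  dwell time the form shrinks by \<open>exp (- 2 \<gamma> \<tau>)\<close>; returning from the form
  to the norm costs at most \<open>|C^T C| exp (\<gamma> \<tau>)\<close>, and a factor
  \<open>exp (- \<gamma> \<tau>)\<close> remains. Several cycles are grouped because
  \<open>\<delta> exp (\<mu> Tc) < 1\<close> controls only the rate: the overshoot constant
  \<open>M\<close> of the matrix exponential may be large. The length \<open>K\<close> of a group
  and the number of intervals in it are fixed before the gain, so the accumulated error can be
  prescribed in advance.\<close>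

lemma right_derivative_nonpos_imp_le:
  fixes g :: "real \<Rightarrow> real"
  assumes ab: "a \<le> b" and cont: "continuous_on {a..b} g"
    and der: "\<And>t. a \<le> t \<Longrightarrow> t < b \<Longrightarrow>
      \<exists>D. (g has_vector_derivative D) (at t within {t..}) \<and> D \<le> 0"
  shows "g b \<le> g a"
proof -
  have eps: "g b \<le> g a + e * (b - a)" if e: "e > 0" for e
  proof -
    \<comment> \<open>Continuous induction: the slope allowance \<open>e\<close> turns
      \<open>D \<le> 0\<close> into the strict \<open>D < e\<close>, which lets the bound be pushed
      a little to the right of any point short of \<open>b\<close>. Left continuity carries it to
      the supremum \<open>c\<close>.\<close>
    define S where "S = {t \<in> {a..b}. \<forall>s\<in>{a..t}. g s \<le> g a + e * (s - a)}"
    have aS: "a \<in> S" using ab by (auto simp: S_def)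
    have bdd: "bdd_above S" by (auto simp: S_def intro!: bdd_aboveI[of _ b])
    define c where "c = Sup S"
    have ac: "a \<le> c" unfolding c_def by (rule cSup_upper[OF aS bdd])
    have cb: "c \<le> b" unfolding c_def by (rule cSup_least) (use aS in \<open>auto simp: S_def\<close>)
    have below: "g s \<le> g a + e * (s - a)" if "a \<le> s" "s < c" for s
    proof -
      have "\<exists>t\<in>S. s < t" by (rule less_cSupD) (use that aS in \<open>auto simp: c_def\<close>)
      then obtain t where "t \<in> S" "s < t" by (elim bexE)
      then show ?thesis using that by (auto simp: S_def)
    qed
    have atc: "g c \<le> g a + e * (c - a)"
    proof (cases "c = a")
      case False
      then have "a < c" using ac by simp
      have "continuous_on {a..c} (\<lambda>t. g t - e * (t - a))"
        using continuous_on_subset[OF cont, of "{a..c}"] cb by (auto intro!: continuous_intros)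
      then have "continuous (at c within {a..c}) (\<lambda>t. g t - e * (t - a))"
        using ac by (auto simp: continuous_on_eq_continuous_within)
      then have lim: "((\<lambda>t. g t - e * (t - a)) \<longlongrightarrow> g c - e * (c - a)) (at_left c)"
        using \<open>a < c\<close> by (simp add: continuous_within at_within_Icc_at_left)
      have ev: "\<forall>\<^sub>F t in at_left c. g t - e * (t - a) \<le> g a"
        unfolding eventually_at_left_field using \<open>a < c\<close> below
        by (intro exI[of _ a]) (simp add: algebra_simps)
      show ?thesis using tendsto_upperbound[OF lim ev] by simp
    qed simp
    have "c = b"
    proof (rule ccontr)
      assume "c \<noteq> b"
      then have "c < b" using cb by simp
      then obtain D where D: "(g has_vector_derivative D) (at c within {c..})" "D \<le> 0"
        using der ac by blast
      have "(g has_field_derivative D) (at c within {c..})"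
        using has_real_derivative_iff_has_vector_derivative[THEN iffD2, OF D(1)] .
      then have "((\<lambda>y. (g y - g c) / (y - c)) \<longlongrightarrow> D) (at c within {c..})"
        by (rule has_field_derivative_iff[THEN iffD1])
      moreover have "D < e" using D e by simp
      ultimately have "\<forall>\<^sub>F y in at c within {c..}. (g y - g c) / (y - c) < e"
        by (rule order_tendstoD(2))
      then obtain d where d: "d > 0" "\<And>y. y \<in> {c..} \<Longrightarrow> y \<noteq> c \<Longrightarrow> dist y c < d \<Longrightarrow> (g y - g c) / (y - c) < e"
        unfolding eventually_at by blast
      define t where "t = min b (c + d / 2)"
      have t: "c < t" "t \<le> b" using \<open>c < b\<close> d by (auto simp: t_def)
      have "g s \<le> g a + e * (s - a)" if "a \<le> s" "s \<le> t" for s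
      proof (cases "s \<le> c")
        case True
        then show ?thesis using below atc that by (cases "s = c") auto
      next
        case False
        then have "(g s - g c) / (s - c) < e"
          using d that by (auto simp: dist_real_def t_def)
        then have "g s - g c < e * (s - c)" using False by (simp add: field_simps)
        then show ?thesis using atc by (simp add: algebra_simps)
      qed
      then have "t \<in> S" using t ac by (auto simp: S_def)
      then have "t \<le> c" unfolding c_def by (rule cSup_upper[OF _ bdd])
      then show False using t by simp
    qed
    then show ?thesis using atc by simp
  qed
  show ?thesis
  proof (cases "a = b")
    case False
    then have "b - a > 0" using ab by simp
    show ?thesis
    proof (rule field_le_epsilon)
      fix e :: real assume "e > 0"
      then show "g b \<le> g a + e" using eps[of "e / (b - a)"] \<open>b - a > 0\<close> by simp
    qed
  qed simp
qed

text \<open>Multiplying by the integrating factor \<open>exp (- k t)\<close> reduces this to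
  monotonicity. The sign of \<open>k\<close> is free; the decay estimates below use it with negative
  \<open>k\<close>.\<close>

lemma right_derivative_exp_bound:
  fixes u :: "real \<Rightarrow> real"
  assumes ab: "a \<le> b" and cont: "continuous_on {a..b} u"
    and der: "\<And>t. a \<le> t \<Longrightarrow> t < b \<Longrightarrow>
      \<exists>D. (u has_vector_derivative D) (at t within {t..}) \<and> D \<le> k * u t"
  shows "u b \<le> exp (k * (b - a)) * u a"
proof -
  define g where "g t = exp (- k * t) * u t" for t
  have "g b \<le> g a"
  proof (rule right_derivative_nonpos_imp_le[OF ab])
    show "continuous_on {a..b} g" unfolding g_def by (intro continuous_intros cont)
    fix t assume t: "a \<le> t" "t < b"
    then obtain D where D: "(u has_vector_derivative D) (at t within {t..})" "D \<le> k * u t"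
      using der by blast
    have "(g has_field_derivative (exp (- k * t) * D + (-k * exp (- k * t)) * u t)) (at t within {t..})"
      unfolding g_def using D(1)
      by (auto intro!: derivative_eq_intros simp: has_real_derivative_iff_has_vector_derivative[symmetric])
    moreover have "exp (- k * t) * D + (-k * exp (- k * t)) * u t = exp (- k * t) * (D - k * u t)"
      by (simp add: algebra_simps)
    moreover have "exp (- k * t) * (D - k * u t) \<le> 0"
      using D(2) by (intro mult_nonneg_nonpos) auto
    ultimately show "\<exists>D. (g has_vector_derivative D) (at t within {t..}) \<and> D \<le> 0"
      unfolding has_real_derivative_iff_has_vector_derivative by metis
  qed
  then have "exp (k * b) * g b \<le> exp (k * b) * g a" by simp
  moreover have "exp (k * b) * g b = u b"
    by (simp add: g_def exp_minus field_simps)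
  moreover have "exp (k * b) * g a = exp (k * (b - a)) * u a"
    by (simp add: g_def exp_minus exp_diff right_diff_distrib field_simps)
  ultimately show ?thesis by simp
qed

lemma has_vector_derivative_inner:
  fixes f g :: "real \<Rightarrow> 'a::real_inner"
  assumes "(f has_vector_derivative f') (at t within S)"
    and "(g has_vector_derivative g') (at t within S)"
  shows "((\<lambda>x. f x \<bullet> g x) has_vector_derivative (f t \<bullet> g' + f' \<bullet> g t)) (at t within S)"
  using bounded_bilinear.has_vector_derivative[OF bounded_bilinear_inner assms] .

lemma gronwall_right_derivative:
  fixes f :: "real \<Rightarrow> 'a::real_inner"
  assumes ab: "a \<le> b" and cont: "continuous_on {a..b} f"
    and der: "\<And>t. a \<le> t \<Longrightarrow> t < b \<Longrightarrow>
      \<exists>D. (f has_vector_derivative D) (at t within {t..}) \<and> norm D \<le> k * norm (f t)"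
  shows "norm (f b) \<le> exp (k * (b - a)) * norm (f a)"
proof -
  \<comment> \<open>The squared norm is differentiable even where the norm vanishes; its rate is
    doubled and a square root is taken at the end.\<close>
  have "f b \<bullet> f b \<le> exp ((2 * k) * (b - a)) * (f a \<bullet> f a)"
  proof (rule right_derivative_exp_bound[OF ab])
    show "continuous_on {a..b} (\<lambda>t. f t \<bullet> f t)" by (intro continuous_intros cont)
    fix t assume "a \<le> t" "t < b"
    then obtain D where D: "(f has_vector_derivative D) (at t within {t..})" "norm D \<le> k * norm (f t)"
      using der by blast
    have "D \<bullet> f t \<le> norm D * norm (f t)" by (rule norm_cauchy_schwarz)
    also have "\<dots> \<le> k * norm (f t) * norm (f t)" by (intro mult_right_mono D) auto
    also have "\<dots> = k * (f t \<bullet> f t)" by (simp add: dot_square_norm power2_eq_square)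
    finally have "f t \<bullet> D + D \<bullet> f t \<le> 2 * k * (f t \<bullet> f t)" by (simp add: inner_commute)
    then show "\<exists>D. ((\<lambda>t. f t \<bullet> f t) has_vector_derivative D) (at t within {t..}) \<and>
        D \<le> (2 * k) * (f t \<bullet> f t)"
      using has_vector_derivative_inner[OF D(1) D(1)] by blast
  qed
  also have "exp ((2 * k) * (b - a)) * (f a \<bullet> f a) = (exp (k * (b - a)) * norm (f a))\<^sup>2"
    by (simp add: dot_square_norm power_mult_distrib exp_double[symmetric] mult_ac)
  finally show ?thesis
    by (simp add: dot_square_norm power2_le_iff_abs_le)
qed

lemma linear_ode_unique:
  fixes f g :: "real \<Rightarrow> 'a::euclidean_space"
  assumes F: "linear F" and ab: "a \<le> b"
    and cont: "continuous_on {a..b} f" "continuous_on {a..b} g"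
    and der: "\<And>t. a \<le> t \<Longrightarrow> t < b \<Longrightarrow> (f has_vector_derivative F (f t)) (at t within {t..})"
      "\<And>t. a \<le> t \<Longrightarrow> t < b \<Longrightarrow> (g has_vector_derivative F (g t)) (at t within {t..})"
    and eq: "f a = g a"
  shows "f b = g b"
proof -
  obtain k where k: "\<And>x. norm (F x) \<le> k * norm x" using linear_bounded[OF F] by blast
  have "norm (f b - g b) \<le> exp (k * (b - a)) * norm (f a - g a)"
  proof (rule gronwall_right_derivative[OF ab])
    show "continuous_on {a..b} (\<lambda>t. f t - g t)" by (intro continuous_intros cont)
    fix t assume t: "a \<le> t" "t < b"
    have "((\<lambda>t. f t - g t) has_vector_derivative F (f t - g t)) (at t within {t..})"
      using has_vector_derivative_diff[OF der(1)[OF t] der(2)[OF t]] by (simp add: linear_diff[OF F])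
    then show "\<exists>D. ((\<lambda>t. f t - g t) has_vector_derivative D) (at t within {t..}) \<and>
        norm D \<le> k * norm (f t - g t)" using k by blast
  qed
  then show ?thesis using eq by simp
qed

text \<open>The solution is the exponential series of \<open>F\<close> applied to \<open>x\<close>.
  It is differentiated coordinate by coordinate, so that the theorem on real power series applies.
  The abstract Euclidean space covers vectors as well as matrices.\<close>

lemma linear_ode_exists:
  fixes F :: "'a::euclidean_space \<Rightarrow> 'a"
  assumes F: "linear F"
  shows "\<exists>\<phi>. \<phi> 0 = x \<and> (\<forall>t. (\<phi> has_vector_derivative F (\<phi> t)) (at t))"
proof -
  obtain k where k: "k > 0" "\<And>x. norm (F x) \<le> k * norm x"
    using linear_bounded_pos[OF F] by blast
  have blF: "bounded_linear F" using F by (simp add: linear_conv_bounded_linear)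
  define p where "p n = (F ^^ n) x" for n
  have p_Suc: "p (Suc n) = F (p n)" for n by (simp add: p_def)
  have p_bound: "norm (p n) \<le> k ^ n * norm x" for n
  proof (induction n)
    case (Suc n)
    have "norm (p (Suc n)) \<le> k * norm (p n)" using k by (simp add: p_Suc)
    also have "\<dots> \<le> k * (k ^ n * norm x)" using k Suc by (intro mult_left_mono) auto
    finally show ?case by (simp add: mult_ac)
  qed (simp add: p_def)
  have summ: "summable (\<lambda>n. (t ^ n / fact n) *\<^sub>R p n)" for t
  proof (rule summable_comparison_test')
    show "summable (\<lambda>n. norm x * ((k * \<bar>t\<bar>) ^ n /\<^sub>R fact n))"
      using summable_exp_generic[of "k * \<bar>t\<bar>"] by (intro summable_mult) (simp add: divide_inverse mult_ac)
    fix n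
    have "norm ((t ^ n / fact n) *\<^sub>R p n) = \<bar>t\<bar> ^ n / fact n * norm (p n)"
      by (simp add: power_abs)
    also have "\<dots> \<le> \<bar>t\<bar> ^ n / fact n * (k ^ n * norm x)"
      by (intro mult_left_mono p_bound) auto
    finally show "norm ((t ^ n / fact n) *\<^sub>R p n) \<le> norm x * ((k * \<bar>t\<bar>) ^ n /\<^sub>R fact n)"
      by (simp add: power_mult_distrib divide_inverse mult_ac)
  qed
  define \<phi> where "\<phi> t = (\<Sum>n. (t ^ n / fact n) *\<^sub>R p n)" for t
  have summb: "summable (\<lambda>n. (p n \<bullet> b / fact n) * t ^ n)" for b t
    using bounded_linear.summable[OF bounded_linear_inner_left[of b] summ[of t]] by (simp add: mult_ac)
  have comp: "\<phi> t \<bullet> b = (\<Sum>n. (p n \<bullet> b / fact n) * t ^ n)" for b t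
    using bounded_linear.suminf[OF bounded_linear_inner_left[of b] summ[of t]]
    by (simp add: mult_ac \<phi>_def)
  have Fphi: "F (\<phi> t) \<bullet> b = (\<Sum>n. (p (Suc n) \<bullet> b / fact n) * t ^ n)" for b t
  proof -
    have "F (\<phi> t) = (\<Sum>n. (t ^ n / fact n) *\<^sub>R p (Suc n))"
      unfolding \<phi>_def bounded_linear.suminf[OF blF summ] by (simp add: linear_scale[OF F] p_Suc)
    moreover have "summable (\<lambda>n. (t ^ n / fact n) *\<^sub>R p (Suc n))"
      using bounded_linear.summable[OF blF summ[of t]] by (simp add: linear_scale[OF F] p_Suc)
    ultimately show ?thesis
      using bounded_linear.suminf[OF bounded_linear_inner_left[of b]] by (simp add: mult_ac)
  qed
  have "(\<phi> has_vector_derivative F (\<phi> t)) (at t)" for t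
    unfolding has_vector_derivative_def
  proof (subst has_derivative_componentwise_within, intro ballI)
    fix b :: 'a assume "b \<in> Basis"
    have "((\<lambda>t. \<Sum>n. (p n \<bullet> b / fact n) * t ^ n) has_field_derivative
        (\<Sum>n. diffs (\<lambda>n. p n \<bullet> b / fact n) n * t ^ n)) (at t)"
      by (rule termdiffs_strong_converges_everywhere[OF summb])
    moreover have "diffs (\<lambda>n. p n \<bullet> b / fact n) = (\<lambda>n. p (Suc n) \<bullet> b / fact n)"
      by (rule ext) (simp add: diffs_def field_simps del: of_nat_Suc)
    ultimately have "((\<lambda>t. \<phi> t \<bullet> b) has_field_derivative F (\<phi> t) \<bullet> b) (at t)"
      by (simp add: comp Fphi)
    then show "((\<lambda>t. \<phi> t \<bullet> b) has_derivative (\<lambda>h. (h *\<^sub>R F (\<phi> t)) \<bullet> b)) (at t)"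
      by (simp add: has_field_derivative_def mult.commute[of _ "F (\<phi> t) \<bullet> b"])
  qed
  moreover have "\<phi> 0 = x"
    unfolding \<phi>_def
    by (subst suminf_finite[of "{0}"]) (auto simp: p_def)
  ultimately show ?thesis by blast
qed

section \<open>Matrix products as bounded linear maps, and the matrix exponential\<close>

lemma matrix_add_rdistrib: "((A::real^'n^'m) + B) ** (C::real^'p^'n) = A ** C + B ** C"
  by (simp add: vec_eq_iff matrix_matrix_mult_def distrib_right sum.distrib)

lemma bounded_linear_matrix_mult_left: "bounded_linear (\<lambda>X::real^'p^'n. (A::real^'n^'m) ** X)"
  by (simp add: linear_conv_bounded_linear[symmetric] linear_iff matrix_add_ldistrib matrix_scalar_ac scalar_matrix_assoc)

lemma bounded_linear_matrix_mult_right: "bounded_linear (\<lambda>X::real^'n^'m. X ** (A::real^'p^'n))"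
  by (simp add: linear_conv_bounded_linear[symmetric] linear_iff matrix_add_rdistrib scalar_matrix_assoc)

lemma has_vector_derivative_matrix_mult_left:
  assumes "(f has_vector_derivative f') (at t within S)"
  shows "((\<lambda>t. (A::real^'n^'m) ** (f t :: real^'p^'n)) has_vector_derivative A ** f') (at t within S)"
  by (rule bounded_linear.has_vector_derivative[OF bounded_linear_matrix_mult_left assms])

lemma has_vector_derivative_matrix_mult_right:
  assumes "(f has_vector_derivative f') (at t within S)"
  shows "((\<lambda>t. (f t :: real^'n^'m) ** (A::real^'p^'n)) has_vector_derivative f' ** A) (at t within S)"
  by (rule bounded_linear.has_vector_derivative[OF bounded_linear_matrix_mult_right assms])

lemma matrix_diff_ldistrib: "(A::real^'n^'m) ** (B - C) = A ** B - A ** (C::real^'p^'n)"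
  by (simp add: vec_eq_iff matrix_matrix_mult_def right_diff_distrib sum_subtractf)

lemma matrix_diff_rdistrib: "((A::real^'n^'m) - B) ** (C::real^'p^'n) = A ** C - B ** C"
  by (simp add: vec_eq_iff matrix_matrix_mult_def left_diff_distrib sum_subtractf)

text \<open>Chosen as a solution of its differential equation instead of as a series: the semigroup
  law and the growth bound need only the equation and the initial value.\<close>

definition matrix_exp :: "real^'n^'n \<Rightarrow> real \<Rightarrow> real^'n^'n" where
  "matrix_exp A = (SOME \<Phi>. \<Phi> 0 = mat 1 \<and> (\<forall>t. (\<Phi> has_vector_derivative A ** \<Phi> t) (at t)))"

lemma
  shows matrix_exp_0: "matrix_exp A 0 = mat 1"
    and has_vector_derivative_matrix_exp:
      "(matrix_exp A has_vector_derivative A ** matrix_exp A t) (at t within S)"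
proof -
  have "linear (\<lambda>X. A ** X)"
    by (rule bounded_linear.linear[OF bounded_linear_matrix_mult_left])
  from someI_ex[OF linear_ode_exists[OF this]]
  have *: "matrix_exp A 0 = mat 1 \<and> (\<forall>t. (matrix_exp A has_vector_derivative A ** matrix_exp A t) (at t))"
    unfolding matrix_exp_def .
  show "matrix_exp A 0 = mat 1" using * by blast
  show "(matrix_exp A has_vector_derivative A ** matrix_exp A t) (at t within S)"
    using * has_vector_derivative_at_within by blast
qed

lemma continuous_on_matrix_exp: "continuous_on S (matrix_exp A)"
  by (rule continuous_on_vector_derivative[OF has_vector_derivative_matrix_exp])

lemma has_vector_derivative_matrix_exp_shift:
  "((\<lambda>t. matrix_exp A (t - c)) has_vector_derivative A ** matrix_exp A (t - c)) (at t within S)"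
proof -
  have "((\<lambda>t. t - c) has_vector_derivative 1) (at t within S)"
    by (auto intro!: derivative_eq_intros)
  from vector_diff_chain_within[OF this has_vector_derivative_matrix_exp]
  show ?thesis by (simp add: o_def)
qed

lemma continuous_on_matrix_exp_shift: "continuous_on S (\<lambda>t. matrix_exp A (t - c))"
  by (rule continuous_on_vector_derivative[OF has_vector_derivative_matrix_exp_shift])

text \<open>As functions of \<open>r\<close>, both sides solve \<open>X' = A X\<close> and agree at
  \<open>r = 0\<close>. Uniqueness is available forward in time, hence
  \<open>0 \<le> r\<close>.\<close>

lemma matrix_exp_add:
  assumes "0 \<le> r"
  shows "matrix_exp A (r + s) = matrix_exp A r ** matrix_exp A s"
proof (rule linear_ode_unique[of "\<lambda>X. A ** X" 0 r])
  show "linear (\<lambda>X. A ** X)" by (rule bounded_linear.linear[OF bounded_linear_matrix_mult_left])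
  show "continuous_on {0..r} (\<lambda>t. matrix_exp A (t + s))"
    using continuous_on_matrix_exp_shift[of _ A "-s"] by simp
  show "continuous_on {0..r} (\<lambda>t. matrix_exp A t ** matrix_exp A s)"
    by (rule bounded_linear.continuous_on[OF bounded_linear_matrix_mult_right continuous_on_matrix_exp])
  show "((\<lambda>t. matrix_exp A (t + s)) has_vector_derivative A ** matrix_exp A (t + s)) (at t within {t..})" for t
    using has_vector_derivative_matrix_exp_shift[of A "-s"] by simp
  show "((\<lambda>t. matrix_exp A t ** matrix_exp A s) has_vector_derivative A ** (matrix_exp A t ** matrix_exp A s)) (at t within {t..})" for t
    using has_vector_derivative_matrix_mult_right[OF has_vector_derivative_matrix_exp[of A t]]
    by (simp add: matrix_mul_assoc)
qed (use assms in \<open>simp_all add: matrix_exp_0\<close>)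

section \<open>Spectral growth bound for the matrix exponential\<close>

context
  fixes A :: "complex^'n^'n"
begin

definition shift :: "complex \<Rightarrow> complex^'n \<Rightarrow> complex^'n" where
  "shift z v = A *v v - z *s v"

text \<open>Products of factors \<open>A - z I\<close> take the place of a Jordan form: removing one
  factor at a time reduces the growth bound to first-order equations with a bounded forcing
  term.\<close>

fun shift_prod :: "complex list \<Rightarrow> complex^'n \<Rightarrow> complex^'n" where
  "shift_prod [] v = v"
| "shift_prod (z # zs) v = shift_prod zs (shift z v)"

definition poly_act :: "complex poly \<Rightarrow> complex^'n \<Rightarrow> complex^'n" where
  "poly_act p v = (\<Sum>k\<le>degree p. coeff p k *s (((*v) A ^^ k) v))"

lemma matrix_power_linear:
  "((*v) A ^^ k) (x - y) = ((*v) A ^^ k) x - ((*v) A ^^ k) y"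
  "((*v) A ^^ k) (c *s x) = c *s ((*v) A ^^ k) x"
  by (induction k) (simp_all add: matrix_vector_mult_diff_distrib vector_scalar_commute)

lemma poly_act_eq_sum:
  assumes "degree p \<le> n"
  shows "poly_act p v = (\<Sum>k\<le>n. coeff p k *s (((*v) A ^^ k) v))"
  unfolding poly_act_def
  by (rule sum.mono_neutral_left) (use assms in \<open>auto simp: coeff_eq_0\<close>)

lemma poly_act_linear_factor: "poly_act ([:- z, 1:] * q) v = poly_act q (shift z v)"
proof -
  let ?n = "degree q"
  have eq: "[:- z, 1:] * q = pCons 0 q - smult z q" by simp
  have deg: "degree (pCons 0 q - smult z q) \<le> Suc ?n"
    by (rule degree_diff_le) (auto simp: degree_pCons_le)
  have "poly_act ([:- z, 1:] * q) v =
      (\<Sum>k\<le>Suc ?n. coeff (pCons 0 q) k *s (((*v) A ^^ k) v)) - (\<Sum>k\<le>Suc ?n. coeff (smult z q) k *s (((*v) A ^^ k) v))"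
    unfolding eq poly_act_eq_sum[OF deg] by (simp add: vector_sub_rdistrib sum_subtractf del: sum.atMost_Suc)
  \<comment> \<open>The coefficient at 0 vanishes; the others move down by one index, and the spare
    power of \<open>A\<close> goes to the vector.\<close>
  also have "(\<Sum>k\<le>Suc ?n. coeff (pCons 0 q) k *s (((*v) A ^^ k) v)) =
      (\<Sum>k\<le>?n. coeff q k *s (((*v) A ^^ k) (A *v v)))"
    by (simp add: sum.atMost_Suc_shift funpow_swap1 del: sum.atMost_Suc)
  also have "(\<Sum>k\<le>Suc ?n. coeff (smult z q) k *s (((*v) A ^^ k) v)) =
      (\<Sum>k\<le>?n. coeff q k *s (((*v) A ^^ k) (z *s v)))"
    by (simp add: coeff_eq_0 matrix_power_linear vector_smult_assoc mult_ac)
  finally show ?thesis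
    by (simp add: poly_act_def shift_def matrix_power_linear vector_ssub_ldistrib sum_subtractf)
qed

text \<open>The fundamental theorem of algebra supplies a root, whose linear factor is split off;
  induction on the degree does the rest.\<close>

lemma poly_act_factorization:
  "p \<noteq> 0 \<Longrightarrow> \<exists>c zs. c \<noteq> 0 \<and> (\<forall>v. poly_act p v = c *s shift_prod zs v)"
proof (induction "degree p" arbitrary: p rule: less_induct)
  case less
  show ?case
  proof (cases "degree p = 0")
    case True
    then obtain c where "p = [:c:]" by (rule degree_eq_zeroE)
    then show ?thesis using less.prems
      by (intro exI[of _ c] exI[of _ "[]"]) (simp add: poly_act_def)
  next
    case False
    then have "\<not> constant (poly p)" by (simp add: constant_degree)
    then obtain z where "poly p z = 0" using fundamental_theorem_of_algebra by blast
    then obtain q where q: "p = [:- z, 1:] * q" by (auto simp: poly_eq_0_iff_dvd elim: dvdE)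
    then have q0: "q \<noteq> 0" using less.prems by auto
    have "degree p = Suc (degree q)" unfolding q using q0 by (subst degree_mult_eq) auto
    then obtain c zs where "c \<noteq> 0" "\<forall>v. poly_act q v = c *s shift_prod zs v"
      using less.hyps[of q] q0 by auto
    then show ?thesis unfolding q
      by (intro exI[of _ c] exI[of _ "z # zs"]) (simp add: poly_act_linear_factor del: mult_pCons_left)
  qed
qed

text \<open>Any annihilating polynomial is good enough, so a dimension count in the real vector
  space of complex matrices stands in for Cayley-Hamilton.\<close>

lemma matrix_powers_dependent:
  "\<exists>(c::nat \<Rightarrow> real) d. (\<exists>k\<le>d. c k \<noteq> 0) \<and> (\<forall>v. (\<Sum>k\<le>d. c k *\<^sub>R ((*v) A ^^ k) v) = 0)"
proof -
  define X where "X k = ((**) A ^^ k) (mat 1)" for k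
  have X: "X k *v v = ((*v) A ^^ k) v" for k v
    by (induction k) (simp_all add: X_def matrix_vector_mul_assoc[symmetric])
  define d where "d = DIM(complex^'n^'n)"
  have "\<exists>c::nat \<Rightarrow> real. (\<exists>k\<le>d. c k \<noteq> 0) \<and> (\<Sum>k\<le>d. c k *\<^sub>R X k) = 0"
  \<comment> \<open>Dependence is a property of sets, in which repeated powers would collapse. Two
    equal powers give a relation with coefficients 1 and -1 directly.\<close>
  proof (cases "inj_on X {..d}")
    case True
    then have "card (X ` {..d}) = Suc d" by (simp add: card_image)
    then have "dependent (X ` {..d})" by (intro dependent_biggerset) (simp add: d_def)
    then obtain u where u: "\<exists>v\<in>X ` {..d}. u v \<noteq> (0::real)" "(\<Sum>v\<in>X ` {..d}. u v *\<^sub>R v) = 0"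
      by (auto simp: dependent_finite)
    then show ?thesis using True
      by (intro exI[of _ "\<lambda>k. u (X k)"]) (auto simp: sum.reindex)
  next
    case False
    then obtain i j where ij: "i \<le> d" "j \<le> d" "i \<noteq> j" "X i = X j" by (auto simp: inj_on_def)
    define c :: "nat \<Rightarrow> real" where "c k = (if k = i then 1 else if k = j then -1 else 0)" for k
    have "(\<Sum>k\<le>d. c k *\<^sub>R X k) = (\<Sum>k\<in>{i,j}. c k *\<^sub>R X k)"
      by (rule sum.mono_neutral_right) (use ij in \<open>auto simp: c_def\<close>)
    also have "\<dots> = 0" using ij by (simp add: c_def)
    finally show ?thesis using ij by (intro exI[of _ c]) (auto simp: c_def)
  qed
  then obtain c :: "nat \<Rightarrow> real" where c: "\<exists>k\<le>d. c k \<noteq> 0" "(\<Sum>k\<le>d. c k *\<^sub>R X k) = 0" by blast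
  have "(\<Sum>k\<le>d. c k *\<^sub>R ((*v) A ^^ k) v) = 0" for v
  proof -
    have lin: "linear (\<lambda>M. M *v v)" for v :: "complex^'n"
      by (rule linearI)
        (simp_all add: vec_eq_iff matrix_vector_mult_def scaleR_sum_right distrib_right sum.distrib)
    have "(\<Sum>k\<le>d. c k *\<^sub>R ((*v) A ^^ k) v) = (\<Sum>k\<le>d. c k *\<^sub>R X k) *v v"
      by (simp add: linear_sum[OF lin] linear_scale[OF lin] X)
    then show ?thesis using c by simp
  qed
  then show ?thesis using c by blast
qed

lemma shift_prod_annihilates_exists: "\<exists>zs. \<forall>v. shift_prod zs v = 0"
proof -
  obtain c :: "nat \<Rightarrow> real" and d where c: "\<exists>k\<le>d. c k \<noteq> 0"
    "\<And>v. (\<Sum>k\<le>d. c k *\<^sub>R ((*v) A ^^ k) v) = 0" using matrix_powers_dependent by blast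
  define p where "p = (\<Sum>k\<le>d. monom (complex_of_real (c k)) k)"
  have co: "coeff p k = (if k \<le> d then of_real (c k) else 0)" for k
    by (auto simp: p_def coeff_sum)
  have "p \<noteq> 0" using c(1) co by (metis coeff_0 of_real_eq_0_iff)
  moreover have "degree p \<le> d" by (rule degree_le) (simp add: co)
  then have "poly_act p v = 0" for v
    using c(2)[of v] by (simp add: poly_act_eq_sum co vec_eq_iff) (simp add: scaleR_conv_of_real)
  ultimately show ?thesis
    using poly_act_factorization[of p] by (metis vector_mul_eq_0)
qed

lemma shift_commute: "shift a (shift b v) = shift b (shift a v)"
  by (simp add: shift_def matrix_vector_mult_diff_distrib vector_scalar_commute vector_ssub_ldistrib
      vector_smult_assoc mult.commute)

lemma shift_prod_shift: "shift_prod zs (shift z v) = shift z (shift_prod zs v)"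
  by (induction zs arbitrary: v) (simp, metis shift_prod.simps(2) shift_commute)

lemma shift_prod_append: "shift_prod (xs @ ys) v = shift_prod ys (shift_prod xs v)"
  by (induction xs arbitrary: v) simp_all

lemma shift_prod_scale: "shift_prod zs (c *s v) = c *s shift_prod zs v"
proof (induction zs arbitrary: v)
  case (Cons z zs)
  have "shift z (c *s v) = c *s shift z v"
    by (simp add: shift_def vector_scalar_commute vector_smult_assoc mult.commute vector_ssub_ldistrib)
  then show ?case using Cons by simp
qed simp

lemma shift_prod_eigenvector:
  assumes "A *v v = z *s v"
  shows "shift_prod zs v = (\<Prod>a\<leftarrow>zs. z - a) *s v"
proof (induction zs)
  case (Cons a zs)
  have "shift a v = (z - a) *s v" by (simp add: shift_def assms vector_sub_rdistrib)
  then show ?case using Cons by (simp only: shift_prod.simps shift_prod_scale) (simp add: vector_smult_assoc)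
qed simp

text \<open>In an annihilating product of minimal length every factor comes from an eigenvalue.\<close>

lemma annihilating_eigenvalues:
  "\<exists>zs. (\<forall>v. shift_prod zs v = 0) \<and> set zs = {z. \<exists>v. v \<noteq> 0 \<and> A *v v = z *s v}"
proof -
  obtain zs where zs: "\<forall>v. shift_prod zs v = 0"
    and min: "\<And>ys. \<forall>v. shift_prod ys v = 0 \<Longrightarrow> length zs \<le> length ys"
    using ex_has_least_nat[of "\<lambda>zs. \<forall>v. shift_prod zs v = 0" _ length] shift_prod_annihilates_exists by blast
  have "\<exists>v. v \<noteq> 0 \<and> A *v v = z *s v" if "z \<in> set zs" for z
  proof -
    obtain as bs where ab: "zs = as @ z # bs" using split_list[OF \<open>z \<in> set zs\<close>] by blast
    have "\<not> (\<forall>v. shift_prod (as @ bs) v = 0)" using min[of "as @ bs"] ab by auto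
    then obtain v where v: "shift_prod (as @ bs) v \<noteq> 0" by blast
    have "shift z (shift_prod (as @ bs) v) = shift_prod zs v"
      by (simp add: ab shift_prod_append shift_prod_shift)
    then have "A *v shift_prod (as @ bs) v = z *s shift_prod (as @ bs) v"
      using zs by (simp add: shift_def)
    then show ?thesis using v by blast
  qed
  moreover have "z \<in> set zs" if "v \<noteq> 0" "A *v v = z *s v" for z v
    using shift_prod_eigenvector[OF that(2), of zs] zs that(1) by (auto simp: prod_list_zero_iff)
  ultimately show ?thesis using zs by blast
qed

text \<open>Multiplication by an imaginary number is skew for the real inner product, so it does not
  change the norm. This is why only real parts of eigenvalues matter for growth.\<close>

lemma inner_complex_scale: "y \<bullet> (z *s y) = Re z * (y \<bullet> y)" for y :: "complex^'n"
  by (simp add: inner_vec_def sum_distrib_left inner_complex_def algebra_simps)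

text \<open>Induction on the factors: \<open>w = (A - z) y\<close> solves the same equation and is
  annihilated by the remaining factors, so it obeys the bound; then \<open>y' = z y + w\<close>. The
  strict gap \<open>Re z < \<mu>\<close> absorbs the polynomial terms that repeated eigenvalues
  would produce.\<close>

lemma shift_prod_ode_bound:
  assumes "\<And>t. (y has_vector_derivative A *v y t) (at t)" and "\<And>t. shift_prod zs (y t) = 0"
    and "\<And>z. z \<in> set zs \<Longrightarrow> Re z < \<mu>"
  shows "\<exists>M. \<forall>t\<ge>0. norm (y t) \<le> M * exp (\<mu> * t)"
  using assms
proof (induction zs arbitrary: y)
  case Nil
  then show ?case by (intro exI[of _ 0]) simp
next
  case (Cons z zs)
  define w where "w t = shift z (y t)" for t
  have bl: "bounded_linear (shift z)"
    unfolding linear_conv_bounded_linear[symmetric] shift_def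
    by (rule linearI) (simp_all add: algebra_simps linear_scale[OF matrix_vector_mul_linear] vec_eq_iff)
  have "\<exists>M. \<forall>t\<ge>0. norm (w t) \<le> M * exp (\<mu> * t)"
  proof (rule Cons.IH)
    show "(w has_vector_derivative A *v w t) (at t)" for t
    proof -
      have "(w has_vector_derivative shift z (A *v y t)) (at t)"
        unfolding w_def by (rule bounded_linear.has_vector_derivative[OF bl Cons.prems(1)])
      then show ?thesis
        by (simp add: w_def shift_def matrix_vector_mult_diff_distrib vector_scalar_commute)
    qed
    show "shift_prod zs (w t) = 0" for t using Cons.prems(2)[of t] by (simp add: w_def)
  qed (use Cons.prems(3) in auto)
  then obtain M where M: "\<And>t. t \<ge> 0 \<Longrightarrow> norm (w t) \<le> M * exp (\<mu> * t)" by blast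
  define d where "d = \<mu> - Re z"
  have d: "d > 0" using Cons.prems(3)[of z] by (simp add: d_def)
  define x where "x t = exp (- \<mu> * t) *\<^sub>R y t" for t
  \<comment> \<open>After the rescaling, \<open>|x|^2\<close> has derivative at most
    \<open>- d |x|^2 + M^2 / d\<close>. The subtracted level \<open>(M / d)^2\<close> is where the
    right side vanishes, which leaves the homogeneous inequality
    \<open>u' \<le> - d u\<close>.\<close>
  define u where "u t = x t \<bullet> x t - (M / d)\<^sup>2" for t
  have xder: "(x has_vector_derivative (exp (- \<mu> * t) *\<^sub>R (A *v y t) - \<mu> *\<^sub>R x t)) (at t within S)" for t S
  proof -
    have "((\<lambda>t. exp (- \<mu> * t)) has_field_derivative - \<mu> * exp (- \<mu> * t)) (at t within S)"
      by (auto intro!: derivative_eq_intros)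
    from has_vector_derivative_scaleR[OF this has_vector_derivative_at_within[OF Cons.prems(1)]]
    show ?thesis unfolding x_def by simp
  qed
  have uder: "(u has_vector_derivative 2 * (x t \<bullet> (exp (- \<mu> * t) *\<^sub>R (A *v y t) - \<mu> *\<^sub>R x t))) (at t within S)" for t S
    unfolding u_def using has_vector_derivative_diff_const[of _ "(M/d)\<^sup>2"] has_vector_derivative_inner[OF xder xder]
    by (simp add: inner_commute)
  have ule: "2 * (x t \<bullet> (exp (- \<mu> * t) *\<^sub>R (A *v y t) - \<mu> *\<^sub>R x t)) \<le> - d * u t" if "t \<ge> 0" for t
  proof -
    define r where "r = exp (- \<mu> * t) *\<^sub>R w t"
    have "exp (- \<mu> * t) *\<^sub>R (A *v y t) = r + z *s x t"
      by (simp add: r_def w_def shift_def x_def vec_eq_iff algebra_simps scaleR_conv_of_real)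
    then have "x t \<bullet> (exp (- \<mu> * t) *\<^sub>R (A *v y t) - \<mu> *\<^sub>R x t) = x t \<bullet> r - d * (x t \<bullet> x t)"
      by (simp add: inner_add_right inner_diff_right inner_complex_scale d_def algebra_simps)
    moreover have "norm r \<le> M"
      using M[OF that] by (simp add: r_def exp_minus field_simps)
    then have "x t \<bullet> r \<le> norm (x t) * M"
      by (meson norm_cauchy_schwarz mult_left_mono norm_ge_zero order_trans)
    \<comment> \<open>Young's inequality, with the weight \<open>d\<close> that spends half of the
      available damping \<open>2 d |x|^2\<close>.\<close>
    moreover have "2 * (norm (x t) * M) \<le> d * (norm (x t))\<^sup>2 + M\<^sup>2 / d"
    proof -
      have "0 \<le> (d * norm (x t) - M)\<^sup>2" by simp
      then have "2 * (norm (x t) * M) * d \<le> (d * (norm (x t))\<^sup>2 + M\<^sup>2 / d) * d"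
        using d by (simp add: power2_eq_square algebra_simps)
      then show ?thesis using d by simp
    qed
    moreover have "d * (M / d)\<^sup>2 = M\<^sup>2 / d" using d by (simp add: power2_eq_square)
    ultimately show ?thesis
      by (simp add: u_def dot_square_norm algebra_simps)
  qed
  have "norm (y t) \<le> sqrt (\<bar>u 0\<bar> + (M / d)\<^sup>2) * exp (\<mu> * t)" if t: "t \<ge> 0" for t
  proof -
    have "u t \<le> exp (- d * (t - 0)) * u 0"
    proof (rule right_derivative_exp_bound[OF t])
      show "continuous_on {0..t} u" by (rule continuous_on_vector_derivative[OF uder])
    qed (use uder ule in blast)
    also have "\<dots> \<le> exp (- d * (t - 0)) * \<bar>u 0\<bar>" by (intro mult_left_mono) auto
    also have "\<dots> \<le> 1 * \<bar>u 0\<bar>" using t d by (intro mult_right_mono) auto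
    finally have "(norm (x t))\<^sup>2 \<le> \<bar>u 0\<bar> + (M / d)\<^sup>2" by (simp add: u_def dot_square_norm)
    then have "norm (x t) \<le> sqrt (\<bar>u 0\<bar> + (M / d)\<^sup>2)" by (rule real_le_rsqrt)
    then show ?thesis by (simp add: x_def exp_minus field_simps)
  qed
  then show ?case by blast
qed

end

text \<open>\<open>Max\<close> says something only about finite sets; finiteness of the spectrum
  comes from its being the set of a list.\<close>

lemma Re_eigenvalue_le_lambda_max:
  assumes "z \<in> eigenvalues A"
  shows "Re z \<le> lambda_max A"
proof -
  have "finite (eigenvalues A)"
    using annihilating_eigenvalues[of "cmat A"] unfolding eigenvalues_def by (metis List.finite_set)
  then show ?thesis using assms unfolding lambda_max_def by (intro Max_ge) auto
qed

lemma norm_matrix_le_columns: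
  fixes M :: "real^'n^'m"
  shows "norm M \<le> (\<Sum>i\<in>(UNIV::'m set). \<Sum>j\<in>(UNIV::'n set). norm (M *v axis j 1))"
proof -
  have "norm M \<le> (\<Sum>i\<in>UNIV. norm (M $ i))" unfolding norm_vec_def by (rule L2_set_le_sum) simp
  also have "\<dots> \<le> (\<Sum>i\<in>(UNIV::'m set). \<Sum>j\<in>(UNIV::'n set). \<bar>M $ i $ j\<bar>)" by (intro sum_mono norm_le_l1_cart)
  also have "\<dots> \<le> (\<Sum>i\<in>(UNIV::'m set). \<Sum>j\<in>(UNIV::'n set). norm (M *v axis j 1))"
  proof (intro sum_mono)
    fix i j
    have "\<bar>M $ i $ j\<bar> = \<bar>(M *v axis j 1) $ i\<bar>" by (simp add: matrix_vector_mult_basis column_def)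
    then show "\<bar>M $ i $ j\<bar> \<le> norm (M *v axis j 1)" by (simp add: component_le_norm_cart)
  qed
  finally show ?thesis .
qed

text \<open>The isometric embedding \<open>cvec\<close> carries each orbit of the real equation to
  one of the complexified equation, where the factor argument applies. The bounds on the images of
  the basis vectors are then added up.\<close>

lemma matrix_exp_growth:
  fixes A :: "real^'n^'n"
  assumes \<mu>: "lambda_max A < \<mu>"
  shows "\<exists>M. \<forall>t\<ge>0. norm (matrix_exp A t) \<le> M * exp (\<mu> * t)"
proof -
  obtain zs where zs: "\<forall>v. shift_prod (cmat A) zs v = 0" "set zs = eigenvalues A"
    using annihilating_eigenvalues[of "cmat A"] unfolding eigenvalues_def by blast
  define cvec :: "real^'n \<Rightarrow> complex^'n" where "cvec x = (\<chi> i. complex_of_real (x $ i))" for x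
  have bl: "bounded_linear (\<lambda>M. cvec (M *v x))" for x
    unfolding linear_conv_bounded_linear[symmetric]
    by (rule linearI) (simp_all add: cvec_def vec_eq_iff matrix_vector_mult_add_rdistrib
        scaleR_matrix_vector_assoc[symmetric], simp add: scaleR_conv_of_real)
  have cA: "cvec (A *v x) = cmat A *v cvec x" for x
    by (simp add: cvec_def cmat_def vec_eq_iff matrix_vector_mult_def)
  have "\<exists>M. \<forall>t\<ge>0. norm (matrix_exp A t *v x) \<le> M * exp (\<mu> * t)" for x
  proof -
    have "\<exists>M. \<forall>t\<ge>0. norm (cvec (matrix_exp A t *v x)) \<le> M * exp (\<mu> * t)"
    proof (rule shift_prod_ode_bound)
      show "((\<lambda>t. cvec (matrix_exp A t *v x)) has_vector_derivative cmat A *v cvec (matrix_exp A t *v x)) (at t)" for t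
        using bounded_linear.has_vector_derivative[OF bl has_vector_derivative_matrix_exp[of A t UNIV]]
        by (simp add: cA matrix_vector_mul_assoc[symmetric])
      show "Re z < \<mu>" if "z \<in> set zs" for z
        using Re_eigenvalue_le_lambda_max[of z A] that zs \<mu> by auto
    qed (use zs in auto)
    moreover have "norm (cvec v) = norm v" for v by (simp add: cvec_def norm_vec_def)
    ultimately show ?thesis by simp
  qed
  then obtain M where M: "\<And>x t. t \<ge> 0 \<Longrightarrow> norm (matrix_exp A t *v x) \<le> M x * exp (\<mu> * t)" by metis
  have "norm (matrix_exp A t) \<le> (\<Sum>i\<in>(UNIV::'n set). \<Sum>j\<in>(UNIV::'n set). M (axis j 1)) * exp (\<mu> * t)"
    if "t \<ge> 0" for t
  proof -
    note norm_matrix_le_columns[of "matrix_exp A t"]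
    also have "(\<Sum>i\<in>(UNIV::'n set). \<Sum>j\<in>(UNIV::'n set). norm (matrix_exp A t *v axis j 1)) \<le>
      (\<Sum>i\<in>(UNIV::'n set). \<Sum>j\<in>(UNIV::'n set). M (axis j 1) * exp (\<mu> * t))"
      by (intro sum_mono M that)
    finally show ?thesis by (simp add: sum_distrib_right mult.assoc)
  qed
  then show ?thesis by blast
qed

section \<open>The Lyapunov equation of the high-gain observer\<close>

lemma inner_transpose_matrix_vector:
  fixes A :: "real^'n^'m"
  shows "x \<bullet> (transpose A *v y) = (A *v x) \<bullet> y"
  by (metis dot_lmul_matrix inner_commute transpose_matrix_vector)

lemma inner_matrix_mult_right:
  fixes M :: "real^'p^'n" and X :: "real^'n^'m"
  shows "(X ** M) \<bullet> Y = X \<bullet> (Y ** transpose M)"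
proof -
  have "(\<Sum>k\<in>UNIV. \<Sum>j\<in>UNIV. X $ i $ j * M $ j $ k * Y $ i $ k) =
      (\<Sum>j\<in>UNIV. \<Sum>k\<in>UNIV. X $ i $ j * M $ j $ k * Y $ i $ k)" for i
    by (rule sum.swap)
  then show ?thesis
    by (simp add: inner_vec_def matrix_matrix_mult_def sum_distrib_right sum_distrib_left transpose_def mult_ac)
qed

lemma norm_vec_square: "(norm y)\<^sup>2 = (\<Sum>i\<in>UNIV. (norm (y $ i))\<^sup>2)" for y :: "'b::real_inner^'k"
  by (simp add: norm_vec_def L2_set_def sum_nonneg)

text \<open>The norm of this matrix type is the Frobenius norm, so Cauchy-Schwarz is applied to each
  row.\<close>

lemma norm_matrix_vector_mult_le:
  fixes A :: "real^'n^'m"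
  shows "norm (A *v x) \<le> norm A * norm x"
proof -
  have "(norm (A *v x))\<^sup>2 = (\<Sum>i\<in>UNIV. (A $ i \<bullet> x)\<^sup>2)"
    by (simp add: norm_vec_square matrix_vector_mul_component)
  also have "\<dots> \<le> (\<Sum>i\<in>UNIV. (norm (A $ i))\<^sup>2 * (norm x)\<^sup>2)"
    by (intro sum_mono) (metis Cauchy_Schwarz_ineq dot_square_norm)
  also have "\<dots> = (norm A * norm x)\<^sup>2"
    by (simp add: norm_vec_square[of A] power_mult_distrib sum_distrib_right)
  finally show ?thesis by (rule power2_le_imp_le) simp
qed

lemma norm_transpose: "norm (transpose A) = norm (A :: real^'n^'m)"
proof -
  have "transpose A \<bullet> transpose A = A \<bullet> A"
    unfolding inner_vec_def transpose_def by (simp) (rule sum.swap)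
  then show ?thesis by (simp add: norm_eq_sqrt_inner)
qed

lemma norm_matrix_matrix_mult_le:
  fixes A :: "real^'n^'m" and B :: "real^'p^'n"
  shows "norm (A ** B) \<le> norm A * norm B"
proof -
  have row: "(A ** B) $ i = transpose B *v (A $ i)" for i
    by (simp add: vec_eq_iff matrix_matrix_mult_def matrix_vector_mult_def transpose_def mult.commute del: transpose_matrix_vector)
  have "(norm (A ** B))\<^sup>2 \<le> (\<Sum>i\<in>UNIV. (norm B * norm (A $ i))\<^sup>2)"
    unfolding norm_vec_square[of "A ** B"] row
    by (intro sum_mono power_mono) (metis norm_matrix_vector_mult_le norm_transpose, simp)
  also have "\<dots> = (norm A * norm B)\<^sup>2"
    by (simp add: norm_vec_square[of A] power_mult_distrib sum_distrib_left mult.commute)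
  finally show ?thesis by (rule power2_le_imp_le) simp
qed

text \<open>This is the usual Lyapunov operator of the shifted matrix
  \<open>A + \<gamma> I\<close>.\<close>

definition lyapunov_op :: "real^'n^'n \<Rightarrow> real \<Rightarrow> real^'n^'n \<Rightarrow> real^'n^'n" where
  "lyapunov_op A \<gamma> W = transpose A ** W + W ** A + (2 * \<gamma>) *\<^sub>R W"

lemma linear_lyapunov_op: "linear (lyapunov_op A \<gamma>)"
  by (rule linearI)
    (simp_all add: lyapunov_op_def matrix_add_ldistrib matrix_add_rdistrib matrix_scalar_ac scalar_matrix_assoc[symmetric] algebra_simps)

lemma transpose_add: "transpose ((A::real^'n^'m) + B) = transpose A + transpose B"
  by (simp add: transpose_def vec_eq_iff)

text \<open>The term \<open>2 \<gamma> W\<close> dominates the two products, whose norms add up to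
  at most \<open>2 |A| |W|\<close>. Besides injectivity, this gives a bound on the solution that
  does not depend on \<open>\<gamma>\<close>.\<close>

lemma norm_le_lyapunov_op:
  assumes "norm A + 1 \<le> \<gamma>"
  shows "norm W \<le> norm (lyapunov_op A \<gamma> W)"
proof -
  have "(2 * \<gamma>) *\<^sub>R W = lyapunov_op A \<gamma> W - (transpose A ** W + W ** A)" by (simp add: lyapunov_op_def)
  then have "norm ((2 * \<gamma>) *\<^sub>R W) \<le> norm (lyapunov_op A \<gamma> W) + norm (transpose A ** W + W ** A)"
    by (metis norm_triangle_ineq4)
  moreover have "norm ((2 * \<gamma>) *\<^sub>R W) = 2 * (\<gamma> * norm W)" using assms norm_ge_zero[of A] by (simp del: norm_ge_zero)
  moreover have "norm (transpose A ** W + W ** A) \<le> norm A * norm W + norm A * norm W"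
    using norm_matrix_matrix_mult_le[of "transpose A" W] norm_matrix_matrix_mult_le[of W A]
    by (intro norm_triangle_le add_mono) (simp_all add: norm_transpose mult.commute)
  moreover have "norm A * norm W + norm W \<le> \<gamma> * norm W"
    using mult_right_mono[OF assms norm_ge_zero[of W]] by (simp add: distrib_right)
  ultimately have "2 * norm W \<le> norm (lyapunov_op A \<gamma> W)" by linarith
  then show ?thesis using norm_ge_zero[of W] by linarith
qed

text \<open>A vector at which a semidefinite form is small is almost in the kernel. Positivity is
  tested at \<open>x - (1/c) M x\<close>, a gradient step, which avoids square roots and
  diagonalisation of \<open>M\<close>.\<close>

lemma psd_norm_square_le:
  fixes M :: "real^'n^'n"
  assumes sym: "transpose M = M" and psd: "\<And>x. 0 \<le> x \<bullet> (M *v x)" and c: "norm M \<le> c" "0 < c"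
  shows "(norm (M *v x))\<^sup>2 \<le> c * (x \<bullet> (M *v x))"
proof -
  define y where "y = M *v x"
  have swap: "u \<bullet> (M *v v) = (M *v u) \<bullet> v" for u v
    using inner_transpose_matrix_vector[of u M v] sym by simp
  have "0 \<le> (x - (1/c) *\<^sub>R y) \<bullet> (M *v (x - (1/c) *\<^sub>R y))" by (rule psd)
  also have "\<dots> = x \<bullet> y - 2 / c * (y \<bullet> y) + (1/c)^2 * (y \<bullet> (M *v y))"
    by (simp add: matrix_vector_mult_diff_distrib matrix_vector_mult_scaleR inner_diff_left inner_diff_right
        y_def[symmetric] swap[of x] inner_commute[of "M *v y"] power2_eq_square) (simp add: algebra_simps inner_commute diff_divide_distrib)
  finally have 1: "0 \<le> x \<bullet> y - 2 / c * (y \<bullet> y) + (1/c)^2 * (y \<bullet> (M *v y))" .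
  have "y \<bullet> (M *v y) \<le> norm y * (norm M * norm y)"
    by (rule order_trans[OF norm_cauchy_schwarz]) (intro mult_left_mono norm_matrix_vector_mult_le norm_ge_zero)
  also have "\<dots> \<le> norm y * (c * norm y)" by (intro mult_left_mono mult_right_mono c) auto
  finally have "y \<bullet> (M *v y) \<le> c * (y \<bullet> y)" by (simp add: dot_square_norm power2_eq_square mult_ac)
  then have "(1/c)^2 * (y \<bullet> (M *v y)) \<le> (1/c)^2 * (c * (y \<bullet> y))" by (intro mult_left_mono) auto
  also have "\<dots> = 1 / c * (y \<bullet> y)" using c by (simp add: power2_eq_square)
  finally have 2: "(1/c)^2 * (y \<bullet> (M *v y)) \<le> 1 / c * (y \<bullet> y)" .
  have "2 / c * (y \<bullet> y) = 1 / c * (y \<bullet> y) + 1 / c * (y \<bullet> y)" by simp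
  then have "1 / c * (y \<bullet> y) \<le> x \<bullet> y" using 1 2 by linarith
  then show ?thesis using c by (simp add: y_def[symmetric] dot_square_norm field_simps)
qed

text \<open>The Lyapunov equation tested at \<open>y\<close>. It is used three times: for positivity
  of \<open>W\<close>, for smallness of outputs, and for the decay of the error form.\<close>

lemma lyapunov_quadratic:
  assumes "lyapunov_op A \<gamma> W = transpose C ** C" "transpose W = W"
  shows "(C *v y) \<bullet> (C *v y) = 2 * ((A *v y) \<bullet> (W *v y)) + 2 * \<gamma> * (y \<bullet> (W *v y))"
proof -
  have sw: "u \<bullet> (W *v v) = (W *v u) \<bullet> v" for u v
    using inner_transpose_matrix_vector[of u W v] assms(2) by simp
  have "(C *v y) \<bullet> (C *v y) = y \<bullet> (lyapunov_op A \<gamma> W *v y)"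
    by (simp only: assms(1) matrix_vector_mul_assoc[symmetric] inner_transpose_matrix_vector)
  also have "\<dots> = y \<bullet> (transpose A *v (W *v y)) + y \<bullet> (W *v (A *v y)) + 2 * \<gamma> * (y \<bullet> (W *v y))"
    by (simp only: lyapunov_op_def matrix_vector_mult_add_rdistrib matrix_vector_mul_assoc
        inner_add_right scaleR_matrix_vector_assoc[symmetric] inner_scaleR_right)
  also have "\<dots> = 2 * ((A *v y) \<bullet> (W *v y)) + 2 * \<gamma> * (y \<bullet> (W *v y))"
    unfolding inner_transpose_matrix_vector by (simp add: sw[of y "A *v y"] inner_commute)
  finally show ?thesis .
qed

text \<open>In finite dimension injectivity of the operator gives surjectivity; \<open>W\<close> is
  symmetric because its transpose solves the same equation.\<close>

lemma lyapunov_solution_exists: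
  fixes A :: "real^'n^'n" and C :: "real^'n^'m"
  assumes \<gamma>: "norm A + 1 \<le> \<gamma>"
  shows "\<exists>W. lyapunov_op A \<gamma> W = transpose C ** C \<and> transpose W = W \<and>
    norm W \<le> norm (transpose C ** C) \<and> (\<forall>x. 0 \<le> x \<bullet> (W *v x))"
proof -
  have inj: "inj (lyapunov_op A \<gamma>)"
    using norm_le_lyapunov_op[OF \<gamma>] by (subst linear_injective_0[OF linear_lyapunov_op]) (metis norm_le_zero_iff norm_zero)
  then have "surj (lyapunov_op A \<gamma>)"
    using linear_injective_imp_surjective[OF linear_lyapunov_op] by blast
  then obtain W where W: "lyapunov_op A \<gamma> W = transpose C ** C" by (metis surjD)
  have "lyapunov_op A \<gamma> (transpose W) = transpose (lyapunov_op A \<gamma> W)"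
    by (simp add: lyapunov_op_def transpose_add matrix_transpose_mul transpose_scalar)
  also have "\<dots> = lyapunov_op A \<gamma> W" by (simp add: W matrix_transpose_mul)
  finally have sym: "transpose W = W" using inj by (simp add: inj_eq)
  have bd: "norm W \<le> norm (transpose C ** C)" using norm_le_lyapunov_op[OF \<gamma>, of W] W by simp
  have "0 \<le> x \<bullet> (W *v x)" for x
  proof (rule ccontr)
    \<comment> \<open>A minimiser of the quadratic form on the sphere would be an eigenvector of \<open>W\<close> with negative
      eigenvalue, contradicting the Lyapunov equation because \<open>\<gamma> > norm A\<close>.\<close>
    assume neg: "\<not> 0 \<le> x \<bullet> (W *v x)"
    then have x0: "x \<noteq> 0" by auto
    define S where "S = sphere (0::real^'n) 1"
    have "continuous_on S (\<lambda>x. x \<bullet> (W *v x))"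
      by (intro continuous_intros linear_continuous_on matrix_vector_mul_bounded_linear)
    moreover have "compact S" "S \<noteq> {}" using x0 by (auto simp: S_def)
    ultimately obtain v where v: "v \<in> S" "\<And>y. y \<in> S \<Longrightarrow> v \<bullet> (W *v v) \<le> y \<bullet> (W *v y)"
      using continuous_attains_inf[of S] by blast
    define m where "m = v \<bullet> (W *v v)"
    have vv: "v \<bullet> v = 1" using v by (simp add: S_def dot_square_norm)
    have ge: "m * (y \<bullet> y) \<le> y \<bullet> (W *v y)" for y
    proof (cases "y = 0")
      case False
      then have "y /\<^sub>R norm y \<in> S" by (simp add: S_def)
      from v(2)[OF this] have "m \<le> (y \<bullet> (W *v y)) / (norm y)\<^sup>2"
        by (simp add: m_def matrix_vector_mult_scaleR divide_simps power2_eq_square)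
      then show ?thesis using False by (simp add: field_simps dot_square_norm)
    qed simp
    have m: "m < 0"
    proof (rule ccontr)
      assume "\<not> m < 0"
      then have "0 \<le> m * (x \<bullet> x)" by simp
      then show False using ge[of x] neg by linarith
    qed
    \<comment> \<open>\<open>M\<close> is positive semidefinite with zero form at the minimiser
      \<open>v\<close>, so \<open>psd_norm_square_le\<close> gives \<open>M v = 0\<close>, that is,
      \<open>v\<close> is an eigenvector for \<open>m\<close>.\<close>
    define M where "M = W - m *\<^sub>R mat 1"
    have Mv: "M *v y = W *v y - m *\<^sub>R y" for y
      by (simp add: M_def matrix_vector_mult_diff_rdistrib scaleR_matrix_vector_assoc[symmetric])
    have "(norm (M *v v))\<^sup>2 \<le> (norm M + 1) * (v \<bullet> (M *v v))"
    proof (rule psd_norm_square_le)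
      show "transpose M = M"
        using sym by (simp add: M_def vec_eq_iff transpose_def mat_def)
      show "0 \<le> y \<bullet> (M *v y)" for y using ge[of y] by (simp add: Mv inner_diff_right)
      show "0 < norm M + 1" using norm_ge_zero[of M] by linarith
    qed simp
    also have "v \<bullet> (M *v v) = 0" by (simp add: Mv inner_diff_right vv m_def)
    finally have Wv: "W *v v = m *\<^sub>R v" by (simp add: Mv)
    have "0 \<le> (C *v v) \<bullet> (C *v v)" by simp
    also have "\<dots> = 2 * ((A *v v) \<bullet> (W *v v)) + 2 * \<gamma> * (v \<bullet> (W *v v))"
      by (rule lyapunov_quadratic[OF W sym])
    also have "\<dots> = 2 * m * ((A *v v) \<bullet> v + \<gamma>)" by (simp add: Wv vv algebra_simps)
    finally have "(A *v v) \<bullet> v + \<gamma> \<le> 0" using m by (simp add: zero_le_mult_iff)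
    moreover have "\<bar>(A *v v) \<bullet> v\<bar> \<le> norm (A *v v) * norm v" by (rule Cauchy_Schwarz_ineq2)
    moreover have "norm v = 1" using v by (simp add: S_def)
    ultimately show False using \<gamma> norm_matrix_vector_mult_le[of A v] by simp
  qed
  then show ?thesis using W sym bd by blast
qed

text \<open>Half of the exponential rate pays for the factor \<open>\<gamma>\<close>, through
  \<open>y \<le> exp y\<close> at \<open>y = \<theta> \<gamma> / 2\<close>.\<close>

lemma id_le_exp_scaled:
  assumes "0 < (\<theta>::real)"
  shows "\<gamma> * exp (- \<theta> * \<gamma>) \<le> (2 / \<theta>) * exp (- (\<theta> / 2) * \<gamma>)"
proof -
  have "\<theta> * \<gamma> / 2 \<le> exp (\<theta> * \<gamma> / 2)" using exp_ge_add_one_self[of "\<theta> * \<gamma> / 2"] by linarith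
  then have "\<gamma> \<le> (2 / \<theta>) * exp (\<theta> * \<gamma> / 2)" using assms by (simp add: field_simps)
  then have "\<gamma> * exp (- \<theta> * \<gamma>) \<le> (2 / \<theta>) * exp (\<theta> * \<gamma> / 2) * exp (- \<theta> * \<gamma>)"
    by (intro mult_right_mono) auto
  also have "\<dots> = (2 / \<theta>) * exp (- (\<theta> / 2) * \<gamma>)"
    by (simp add: mult.assoc exp_add[symmetric])
  finally show ?thesis .
qed

definition lyapunov_solution :: "real^'n^'n \<Rightarrow> real^'n^'m \<Rightarrow> real \<Rightarrow> real^'n^'n \<Rightarrow> bool" where
  "lyapunov_solution A C \<gamma> W \<longleftrightarrow> norm A + 1 \<le> \<gamma> \<and> lyapunov_op A \<gamma> W = transpose C ** C \<and> transpose W = W \<and>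
    norm W \<le> norm (transpose C ** C) \<and> (\<forall>x. 0 \<le> x \<bullet> (W *v x))"

lemma norm_matrix_funpow_le: "norm (((*v) A ^^ k) x) \<le> norm A ^ k * norm x" for A :: "real^'n^'n"
proof (induction k)
  case (Suc k)
  have "norm (((*v) A ^^ Suc k) x) \<le> norm A * norm (((*v) A ^^ k) x)"
    by (simp add: norm_matrix_vector_mult_le)
  also have "\<dots> \<le> norm A * (norm A ^ k * norm x)" by (intro mult_left_mono Suc) auto
  finally show ?case by (simp add: mult_ac)
qed simp

text \<open>Passes smallness from \<open>W y\<close> to the output \<open>C y\<close>, at the price
  of one factor \<open>\<gamma>\<close>.\<close>

lemma lyapunov_output_le:
  assumes L: "lyapunov_solution A C \<gamma> W"
  shows "(norm (C *v y))\<^sup>2 \<le> 4 * \<gamma> * norm y * norm (W *v y)"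
proof -
  have \<gamma>: "norm A \<le> \<gamma>" "0 \<le> \<gamma>" using L norm_ge_zero[of A] unfolding lyapunov_solution_def by linarith+
  have "(norm (C *v y))\<^sup>2 = 2 * ((A *v y) \<bullet> (W *v y)) + 2 * \<gamma> * (y \<bullet> (W *v y))"
    using lyapunov_quadratic[of A \<gamma> W C y] L by (simp add: lyapunov_solution_def dot_square_norm)
  also have "\<dots> \<le> 2 * (norm A * norm y * norm (W *v y)) + 2 * \<gamma> * (norm y * norm (W *v y))"
    using \<gamma> by (intro add_mono mult_left_mono norm_cauchy_schwarz
      order_trans[OF norm_cauchy_schwarz mult_right_mono[OF norm_matrix_vector_mult_le]]) auto
  also have "\<dots> \<le> 2 * (\<gamma> * norm y * norm (W *v y)) + 2 * \<gamma> * (norm y * norm (W *v y))"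
    using \<gamma> by (intro add_mono mult_left_mono mult_right_mono) auto
  finally show ?thesis by (simp add: algebra_simps)
qed

text \<open>
  If the quadratic form of \<open>W\<close> were exponentially small in \<open>\<gamma>\<close> at a unit vector \<open>x\<close>, then the Lyapunov
  equation, read as \<open>W A y = C\<^sup>T C y - A\<^sup>T W y - 2 \<gamma> W y\<close>, would propagate the smallness along the
  orbit \<open>A\<^sup>k x\<close>, and all \<open>C A\<^sup>k x\<close> would be small, contradicting observability.
\<close>

lemma lyapunov_orbit_bound:
  fixes A :: "real^'n^'n" and C :: "real^'n^'m"
  assumes "\<tau> > 0"
  shows "\<exists>D \<theta>. 0 \<le> D \<and> 0 < \<theta> \<and> (\<forall>\<gamma> W x. lyapunov_solution A C \<gamma> W \<longrightarrow> norm x = 1 \<longrightarrow>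
    x \<bullet> (W *v x) \<le> exp (- \<gamma> * \<tau>) \<longrightarrow> norm (W *v (((*v) A ^^ k) x)) \<le> D * exp (- \<theta> * \<gamma>))"
proof (induction k)
  case 0
  define c where "c = norm (transpose C ** C) + 1"
  have c: "c > 0" using norm_ge_zero[of "transpose C ** C"] unfolding c_def by linarith
  \<comment> \<open>The form controls the square of \<open>|W x|\<close>, so the rate is halved;
    \<open>c\<close> does not depend on \<open>\<gamma>\<close> because the bound on
    \<open>norm W\<close> does not.\<close>
  have "norm (W *v x) \<le> sqrt c * exp (- (\<tau> / 2) * \<gamma>)"
    if L: "lyapunov_solution A C \<gamma> W" "x \<bullet> (W *v x) \<le> exp (- \<gamma> * \<tau>)" for \<gamma> W x
  proof -
    have "(norm (W *v x))\<^sup>2 \<le> c * (x \<bullet> (W *v x))"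
      by (rule psd_norm_square_le) (use L c in \<open>auto simp: lyapunov_solution_def c_def\<close>)
    also have "\<dots> \<le> c * exp (- \<gamma> * \<tau>)" using L c by (intro mult_left_mono) auto
    also have "\<dots> = (sqrt c * exp (- (\<tau> / 2) * \<gamma>))\<^sup>2"
      using c by (simp add: power_mult_distrib exp_double[symmetric] mult_ac)
    finally show ?thesis by (rule power2_le_imp_le) (use c in simp)
  qed
  then show ?case using c assms by (intro exI[of _ "sqrt c"] exI[of _ "\<tau> / 2"]) auto
next
  case (Suc k)
  then obtain D \<theta> where D: "0 \<le> D" and \<theta>: "0 < \<theta>"
    and IH: "\<And>\<gamma> W x. lyapunov_solution A C \<gamma> W \<Longrightarrow> norm x = 1 \<Longrightarrow> x \<bullet> (W *v x) \<le> exp (- \<gamma> * \<tau>) \<Longrightarrow>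
      norm (W *v (((*v) A ^^ k) x)) \<le> D * exp (- \<theta> * \<gamma>)" by blast
  \<comment> \<open>\<open>b\<close> is the constant in
    \<open>|C y|^2 \<le> b exp (- (\<theta> / 2) \<gamma>)\<close>, so \<open>C y\<close> has rate
    \<open>\<theta> / 4\<close>. Each application of \<open>A\<close> thus quarters the rate. This
    loss is harmless, since observability involves only finitely many \<open>k\<close>, and
    \<open>D\<close> and \<open>\<theta>\<close> are independent of \<open>\<gamma>\<close>,
    \<open>W\<close> and \<open>x\<close>.\<close>
  define b where "b = 8 * norm A ^ k * D / \<theta>"
  have b: "0 \<le> b" using D \<theta> by (simp add: b_def)
  have "norm (W *v (((*v) A ^^ Suc k) x)) \<le> (norm C * sqrt b + 6 * D / \<theta>) * exp (- (\<theta> / 4) * \<gamma>)"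
    if L: "lyapunov_solution A C \<gamma> W" and x: "norm x = 1" "x \<bullet> (W *v x) \<le> exp (- \<gamma> * \<tau>)" for \<gamma> W x
  proof -
    define y where "y = ((*v) A ^^ k) x"
    have \<gamma>: "norm A \<le> \<gamma>" "0 < \<gamma>" using L norm_ge_zero[of A] unfolding lyapunov_solution_def by linarith+
    have Wy: "norm (W *v y) \<le> D * exp (- \<theta> * \<gamma>)" unfolding y_def by (rule IH[OF L x])
    have ny: "norm y \<le> norm A ^ k" using norm_matrix_funpow_le[of k A x] x by (simp add: y_def)
    have "(norm (C *v y))\<^sup>2 \<le> 4 * \<gamma> * norm y * norm (W *v y)" by (rule lyapunov_output_le[OF L])
    also have "\<dots> \<le> 4 * \<gamma> * norm A ^ k * (D * exp (- \<theta> * \<gamma>))"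
      using \<gamma> Wy ny by (intro mult_mono) auto
    also have "\<dots> = (4 * norm A ^ k * D) * (\<gamma> * exp (- \<theta> * \<gamma>))" by simp
    also have "\<dots> \<le> (4 * norm A ^ k * D) * ((2 / \<theta>) * exp (- (\<theta> / 2) * \<gamma>))"
      using D by (intro mult_left_mono id_le_exp_scaled \<theta>) auto
    also have "\<dots> = (sqrt b * exp (- (\<theta> / 4) * \<gamma>))\<^sup>2"
      using b by (simp add: power_mult_distrib exp_double[symmetric] b_def)
    finally have Cy: "norm (C *v y) \<le> sqrt b * exp (- (\<theta> / 4) * \<gamma>)"
      by (rule power2_le_imp_le) (use b in simp)
    have "lyapunov_op A \<gamma> W *v y = (transpose C ** C) *v y"
      using L by (simp add: lyapunov_solution_def)
    then have "W *v (A *v y) = transpose C *v (C *v y) - transpose A *v (W *v y) - (2 * \<gamma>) *\<^sub>R (W *v y)"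
      unfolding lyapunov_op_def
      by (simp add: matrix_vector_mult_add_rdistrib matrix_vector_mul_assoc[symmetric] scaleR_matrix_vector_assoc[symmetric] algebra_simps
        del: transpose_matrix_vector)
    then have "norm (W *v (A *v y)) \<le> norm (transpose C *v (C *v y)) + norm (transpose A *v (W *v y)) + norm ((2 * \<gamma>) *\<^sub>R (W *v y))"
      by (simp only:) (rule order_trans[OF norm_triangle_ineq4 add_right_mono[OF norm_triangle_ineq4]])
    also have "\<dots> \<le> norm C * norm (C *v y) + norm A * norm (W *v y) + 2 * \<gamma> * norm (W *v y)"
      using norm_matrix_vector_mult_le[of "transpose C" "C *v y"] norm_matrix_vector_mult_le[of "transpose A" "W *v y"] \<gamma>
      by (simp add: norm_transpose)
    also have "\<dots> \<le> norm C * norm (C *v y) + 3 * \<gamma> * norm (W *v y)"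
      using mult_right_mono[OF \<gamma>(1) norm_ge_zero[of "W *v y"]] by simp
    also have "\<dots> \<le> norm C * (sqrt b * exp (- (\<theta> / 4) * \<gamma>)) + 3 * \<gamma> * (D * exp (- \<theta> * \<gamma>))"
      using \<gamma> by (intro add_mono mult_left_mono Cy Wy) auto
    also have "3 * \<gamma> * (D * exp (- \<theta> * \<gamma>)) = (3 * D) * (\<gamma> * exp (- \<theta> * \<gamma>))" by simp
    also have "\<dots> \<le> (3 * D) * ((2 / \<theta>) * exp (- (\<theta> / 2) * \<gamma>))"
      using D by (intro mult_left_mono id_le_exp_scaled \<theta>) auto
    also have "\<dots> \<le> (3 * D) * ((2 / \<theta>) * exp (- (\<theta> / 4) * \<gamma>))"
      using D \<theta> \<gamma> by (intro mult_left_mono) auto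
    finally show ?thesis by (simp add: y_def algebra_simps)
  qed
  then show ?case using D \<theta> b
    by (intro exI[of _ "norm C * sqrt b + 6 * D / \<theta>"] exI[of _ "\<theta> / 4"]) auto
qed

text \<open>The exponent \<open>\<tau>\<close> is arbitrary here. It is later the dwell time, so
  that the price of leaving the form is only half of the decay
  \<open>exp (- 2 \<gamma> \<tau>)\<close> in logarithmic scale.\<close>

lemma lyapunov_eventually_lower_bound:
  fixes A :: "real^'n^'n" and C :: "real^'n^'m"
  assumes obs: "observable C A" and \<tau>: "\<tau> > 0"
  shows "\<forall>\<^sub>F \<gamma> in at_top. \<forall>W. lyapunov_solution A C \<gamma> W \<longrightarrow>
    (\<forall>x. exp (- \<gamma> * \<tau>) * (norm x)\<^sup>2 \<le> x \<bullet> (W *v x))"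
proof -
  let ?n = "CARD('n)"
  define S where "S = sphere (0::real^'n) 1"
  \<comment> \<open>The quadratic form of the observability matrix. Observability and compactness
    give it a positive minimum \<open>q v\<close> on the sphere; if each of the \<open>?n\<close>
    summands at some unit vector fell below \<open>q v / ?n\<close>, that minimum would be
    undercut.\<close>
  define q where "q x = (\<Sum>k<?n. (norm (C *v (((*v) A ^^ k) x)))\<^sup>2)" for x
  have S: "compact S" "S \<noteq> {}" by (auto simp: S_def)
  have pw: "continuous_on S (\<lambda>x. ((*v) A ^^ k) x)" for k
    by (induction k) (auto intro!: continuous_intros bounded_linear.continuous_on[OF matrix_vector_mul_bounded_linear])
  have "continuous_on S q" unfolding q_def
    by (intro continuous_intros bounded_linear.continuous_on[OF matrix_vector_mul_bounded_linear] pw)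
  then obtain v where v: "v \<in> S" "\<And>y. y \<in> S \<Longrightarrow> q v \<le> q y"
    using continuous_attains_inf[OF S] by blast
  have "q v \<noteq> 0"
  proof
    assume "q v = 0"
    then have "\<forall>k<?n. C *v (((*v) A ^^ k) v) = 0" by (simp add: q_def sum_nonneg_eq_0_iff)
    then have "v = 0" using obs by (simp add: observable_def)
    then show False using v by (simp add: S_def)
  qed
  moreover have "0 \<le> q v" by (simp add: q_def sum_nonneg)
  ultimately have qv: "0 < q v" by simp
  have "\<forall>\<^sub>F \<gamma> in at_top. \<forall>W x. lyapunov_solution A C \<gamma> W \<longrightarrow> norm x = 1 \<longrightarrow>
    x \<bullet> (W *v x) \<le> exp (- \<gamma> * \<tau>) \<longrightarrow> (norm (C *v (((*v) A ^^ k) x)))\<^sup>2 < q v / ?n" for k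
  proof -
    obtain D \<theta> where D: "0 \<le> D" and \<theta>: "0 < \<theta>"
      and bd: "\<And>\<gamma> W x. lyapunov_solution A C \<gamma> W \<Longrightarrow> norm x = 1 \<Longrightarrow> x \<bullet> (W *v x) \<le> exp (- \<gamma> * \<tau>) \<Longrightarrow>
        norm (W *v (((*v) A ^^ k) x)) \<le> D * exp (- \<theta> * \<gamma>)"
      using lyapunov_orbit_bound[OF \<tau>, of A C k] by blast
    have "((\<lambda>\<gamma>. 4 * norm A ^ k * D * (\<gamma> * exp (- \<theta> * \<gamma>))) \<longlongrightarrow> 4 * norm A ^ k * D * 0) at_top"
    proof (intro tendsto_mult_left)
      have "((\<lambda>\<gamma>. 2 / \<theta> * exp (- (\<theta> / 2) * \<gamma>)) \<longlongrightarrow> 2 / \<theta> * 0) at_top"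
        using \<theta> by (intro tendsto_mult_left filterlim_compose[OF exp_at_bot] filterlim_tendsto_neg_mult_at_bot[OF tendsto_const _ filterlim_ident]) auto
      then have lim: "((\<lambda>\<gamma>. 2 / \<theta> * exp (- (\<theta> / 2) * \<gamma>)) \<longlongrightarrow> 0) at_top" by simp
      have lower: "\<forall>\<^sub>F \<gamma> in at_top. 0 \<le> \<gamma> * exp (- \<theta> * \<gamma>)"
        using eventually_ge_at_top[of 0] by (rule eventually_mono) simp
      have upper: "\<forall>\<^sub>F \<gamma> in at_top. \<gamma> * exp (- \<theta> * \<gamma>) \<le> 2 / \<theta> * exp (- (\<theta> / 2) * \<gamma>)"
        using id_le_exp_scaled[OF \<theta>] by (intro always_eventually allI)
      show "((\<lambda>\<gamma>. \<gamma> * exp (- \<theta> * \<gamma>)) \<longlongrightarrow> 0) at_top"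
        by (rule tendsto_sandwich[OF lower upper tendsto_const lim])
    qed
    moreover have "4 * norm A ^ k * D * 0 < q v / ?n" using qv by simp
    ultimately have "\<forall>\<^sub>F \<gamma> in at_top. 4 * norm A ^ k * D * (\<gamma> * exp (- \<theta> * \<gamma>)) < q v / ?n"
      by (rule order_tendstoD(2))
    then show ?thesis
    proof (rule eventually_mono, intro allI impI)
      fix \<gamma> W x
      assume lt: "4 * norm A ^ k * D * (\<gamma> * exp (- \<theta> * \<gamma>)) < q v / ?n"
        and L: "lyapunov_solution A C \<gamma> W" and x: "norm x = 1" "x \<bullet> (W *v x) \<le> exp (- \<gamma> * \<tau>)"
      have \<gamma>: "0 \<le> \<gamma>" using L norm_ge_zero[of A] unfolding lyapunov_solution_def by linarith
      have ny: "norm (((*v) A ^^ k) x) \<le> norm A ^ k" using norm_matrix_funpow_le[of k A x] x by simp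
      have "(norm (C *v (((*v) A ^^ k) x)))\<^sup>2 \<le> 4 * \<gamma> * norm (((*v) A ^^ k) x) * norm (W *v (((*v) A ^^ k) x))"
        by (rule lyapunov_output_le[OF L])
      also have "\<dots> \<le> 4 * \<gamma> * norm A ^ k * (D * exp (- \<theta> * \<gamma>))"
        using \<gamma> bd[OF L x] ny by (intro mult_mono) auto
      finally show "(norm (C *v (((*v) A ^^ k) x)))\<^sup>2 < q v / ?n" using lt by (simp add: mult_ac)
    qed
  qed
  then have "\<forall>\<^sub>F \<gamma> in at_top. \<forall>k\<in>{..<?n}. \<forall>W x. lyapunov_solution A C \<gamma> W \<longrightarrow> norm x = 1 \<longrightarrow>
    x \<bullet> (W *v x) \<le> exp (- \<gamma> * \<tau>) \<longrightarrow> (norm (C *v (((*v) A ^^ k) x)))\<^sup>2 < q v / ?n"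
    by (intro eventually_ball_finite) auto
  then show ?thesis
  proof (rule eventually_mono, intro allI impI)
    fix \<gamma> W x
    assume *: "\<forall>k\<in>{..<?n}. \<forall>W x. lyapunov_solution A C \<gamma> W \<longrightarrow> norm x = 1 \<longrightarrow>
      x \<bullet> (W *v x) \<le> exp (- \<gamma> * \<tau>) \<longrightarrow> (norm (C *v (((*v) A ^^ k) x)))\<^sup>2 < q v / ?n"
      and L: "lyapunov_solution A C \<gamma> W"
    have unit: "exp (- \<gamma> * \<tau>) \<le> u \<bullet> (W *v u)" if u: "norm u = 1" for u
    proof (rule ccontr)
      assume "\<not> exp (- \<gamma> * \<tau>) \<le> u \<bullet> (W *v u)"
      then have "q u < (\<Sum>k<?n. q v / ?n)"
        unfolding q_def[of u] using * L u by (intro sum_strict_mono) (auto simp: lessThan_empty_iff)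
      also have "\<dots> = q v" by simp
      finally show False using v(2)[of u] u by (simp add: S_def)
    qed
    show "exp (- \<gamma> * \<tau>) * (norm x)\<^sup>2 \<le> x \<bullet> (W *v x)"
    proof (cases "x = 0")
      case False
      then have "exp (- \<gamma> * \<tau>) \<le> (x /\<^sub>R norm x) \<bullet> (W *v (x /\<^sub>R norm x))" by (intro unit) simp
      also have "\<dots> = (x \<bullet> (W *v x)) / (norm x)\<^sup>2"
        by (simp add: matrix_vector_mult_scaleR divide_simps power2_eq_square)
      finally show ?thesis using False by (simp add: field_simps)
    qed simp
  qed
qed

section \<open>The kernel projection and coercivity of \<open>H\<close>\<close>

text \<open>Licenses the definite description in \<open>orth_proj\<close>. Two candidates for the
  projection of \<open>x\<close> differ by an element of \<open>S\<close> orthogonal to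
  \<open>S\<close>; this uniqueness also makes the pointwise choice linear, hence a matrix.\<close>

lemma orth_proj_unique_exists:
  fixes S :: "(real^'N) set"
  assumes "subspace S"
  shows "\<exists>!P::real^'N^'N. \<forall>x. P *v x \<in> S \<and> (\<forall>y\<in>S. (x - P *v x) \<bullet> y = 0)"
proof (rule ex_ex1I)
  have span: "span S = S" using assms by (simp add: span_eq_iff)
  have "\<exists>y. y \<in> S \<and> (\<forall>w\<in>S. (x - y) \<bullet> w = 0)" for x
    using orthogonal_subspace_decomp_exists[of S x] unfolding span orthogonal_def
    by (metis add_diff_cancel_left')
  then obtain f where f: "\<And>x. f x \<in> S" "\<And>x w. w \<in> S \<Longrightarrow> (x - f x) \<bullet> w = 0" by metis
  have uniq: "f x = y" if "y \<in> S" "\<And>w. w \<in> S \<Longrightarrow> (x - y) \<bullet> w = 0" for x y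
  proof -
    have d: "f x - y \<in> S" using f(1) that(1) assms by (simp add: subspace_diff)
    have "(f x - y) \<bullet> (f x - y) = (x - y) \<bullet> (f x - y) - (x - f x) \<bullet> (f x - y)"
      by (simp add: inner_diff_left)
    then show ?thesis using f(2)[OF d] that(2)[OF d] by simp
  qed
  have "linear f"
  proof (rule linearI)
    show "f (x + y) = f x + f y" for x y
    proof (rule uniq)
      show "f x + f y \<in> S" using f(1) assms by (simp add: subspace_add)
      show "(x + y - (f x + f y)) \<bullet> w = 0" if "w \<in> S" for w
        using f(2)[OF that, of x] f(2)[OF that, of y] by (simp add: inner_diff_left inner_add_left)
    qed
    show "f (c *\<^sub>R x) = c *\<^sub>R f x" for c x
    proof (rule uniq)
      show "c *\<^sub>R f x \<in> S" using f(1) assms by (simp add: subspace_scale)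
      show "(c *\<^sub>R x - c *\<^sub>R f x) \<bullet> w = 0" if "w \<in> S" for w
        using f(2)[OF that, of x] by (simp add: inner_diff_left)
    qed
  qed
  then have "matrix f *v x = f x" for x by (simp add: matrix_works)
  then show "\<exists>P::real^'N^'N. \<forall>x. P *v x \<in> S \<and> (\<forall>y\<in>S. (x - P *v x) \<bullet> y = 0)"
    using f by (intro exI[of _ "matrix f"]) auto
  fix P Q :: "real^'N^'N"
  assume "\<forall>x. P *v x \<in> S \<and> (\<forall>y\<in>S. (x - P *v x) \<bullet> y = 0)" "\<forall>x. Q *v x \<in> S \<and> (\<forall>y\<in>S. (x - Q *v x) \<bullet> y = 0)"
  then have "P *v x = Q *v x" for x using uniq by metis
  then show "P = Q" by (simp add: matrix_eq)
qed

context
  fixes S :: "(real^'N) set"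
  assumes S: "subspace S"
begin

lemma orth_proj_in: "orth_proj S *v x \<in> S"
  and orth_proj_orthogonal: "y \<in> S \<Longrightarrow> (x - orth_proj S *v x) \<bullet> y = 0"
  using theI'[OF orth_proj_unique_exists[OF S]] unfolding orth_proj_def by blast+

lemma transpose_orth_proj: "transpose (orth_proj S) = orth_proj S"
proof -
  let ?P = "orth_proj S"
  have "x \<bullet> (?P *v y) = (?P *v x) \<bullet> y" for x y
  proof -
    have "x \<bullet> (?P *v y) = (?P *v x) \<bullet> (?P *v y)" "y \<bullet> (?P *v x) = (?P *v y) \<bullet> (?P *v x)"
      using orth_proj_orthogonal[OF orth_proj_in, of x y] orth_proj_orthogonal[OF orth_proj_in, of y x]
      by (simp_all add: inner_diff_left)
    then show ?thesis by (metis inner_commute)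
  qed
  then have "x \<bullet> (transpose ?P *v y) = x \<bullet> (?P *v y)" for x y
    unfolding inner_transpose_matrix_vector by simp
  then have "transpose ?P *v y = ?P *v y" for y by (metis vector_eq_rdot inner_commute)
  then show ?thesis unfolding matrix_eq by blast
qed

lemma orth_proj_idem: "orth_proj S ** orth_proj S = orth_proj S"
proof -
  have "(x - orth_proj S *v x) = 0" if "x \<in> S" for x
  proof -
    have "x - orth_proj S *v x \<in> S" using that orth_proj_in S by (simp add: subspace_diff)
    then show ?thesis using orth_proj_orthogonal[of "x - orth_proj S *v x" x] by simp
  qed
  then show ?thesis using orth_proj_in by (simp add: matrix_eq matrix_vector_mul_assoc[symmetric])
qed

lemma norm_orth_proj_le: "norm (orth_proj S *v x) \<le> norm x"
proof -
  let ?p = "orth_proj S *v x"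
  have "?p \<bullet> ?p = x \<bullet> ?p" using orth_proj_orthogonal[OF orth_proj_in, of x x] by (simp add: inner_diff_left)
  also have "\<dots> \<le> norm x * norm ?p" by (rule norm_cauchy_schwarz)
  finally show ?thesis by (cases "?p = 0") (simp_all add: dot_square_norm power2_eq_square)
qed

lemma norm_orth_proj_complement_le: "norm (x - orth_proj S *v x) \<le> norm x"
proof -
  let ?p = "orth_proj S *v x"
  have "(x - ?p) \<bullet> (x - ?p) = (x - ?p) \<bullet> x" using orth_proj_orthogonal[OF orth_proj_in, of x x]
    by (simp add: inner_diff_right)
  also have "\<dots> \<le> norm (x - ?p) * norm x" by (rule norm_cauchy_schwarz)
  finally show ?thesis by (cases "x - ?p = 0") (simp_all add: dot_square_norm power2_eq_square)
qed

end

lemma matrix_inner_columns: "X \<bullet> Y = (\<Sum>k\<in>UNIV. column k X \<bullet> column k Y)" for X Y :: "real^'p^'n"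
  unfolding inner_vec_def column_def by simp (rule sum.swap)

lemma column_matrix_mult: "column k (M ** X) = M *v column k X" for X :: "real^'p^'n" and M :: "real^'n^'m"
  by (simp add: vec_eq_iff column_def matrix_matrix_mult_def matrix_vector_mult_def)

lemma norm_matrix_columns: "(norm X)\<^sup>2 = (\<Sum>k\<in>UNIV. (norm (column k X))\<^sup>2)" for X :: "real^'p^'n"
  unfolding power2_norm_eq_inner by (rule matrix_inner_columns)

text \<open>The squared Frobenius norm is the sum over the columns, so an operator bound on vectors
  transfers without a dimension factor. The contraction by \<open>\<delta>\<close> per cycle
  therefore survives for stacked errors.\<close>

lemma norm_matrix_mult_columnwise_le:
  fixes M :: "real^'n^'m" and X :: "real^'p^'n"
  assumes "\<And>x. norm (M *v x) \<le> c * norm x" "0 \<le> c"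
  shows "norm (M ** X) \<le> c * norm X"
proof -
  have "(norm (M ** X))\<^sup>2 \<le> (\<Sum>k\<in>UNIV. (c * norm (column k X))\<^sup>2)"
    unfolding norm_matrix_columns[of "M ** X"] column_matrix_mult
    by (intro sum_mono power_mono assms) auto
  also have "\<dots> = (c * norm X)\<^sup>2"
    by (simp add: norm_matrix_columns[of X] power_mult_distrib sum_distrib_left)
  finally show ?thesis by (rule power2_le_imp_le) (use assms in simp)
qed

lemma norm_matrix_mult_induced_norm: "norm (M ** X) \<le> induced_norm M * norm X" for M :: "real^'n^'n"
  unfolding induced_norm_def
  by (intro norm_matrix_mult_columnwise_le onorm onorm_pos_le matrix_vector_mul_bounded_linear)

text \<open>Symmetry concerns edges between followers only. Loops are excluded because the diagonal
  sum in \<open>laplacian\<close> also runs over the node itself.\<close>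

definition undirected_graph :: "('N option \<times> 'N option) set \<Rightarrow> bool" where
  "undirected_graph E \<longleftrightarrow> (\<forall>(a, b)\<in>E. a \<noteq> b) \<and> (\<forall>i j. (Some i, Some j) \<in> E \<longleftrightarrow> (Some j, Some i) \<in> E)"

context
  fixes E :: "('N::finite option \<times> 'N option) set"
  assumes E: "undirected_graph E"
begin

abbreviation follower_adj where "follower_adj i j \<equiv> adj E (Some i) (Some j)"

lemma adj_sym: "follower_adj i j = follower_adj j i" and adj_irrefl: "follower_adj i i = 0" and adj_nonneg: "0 \<le> adj E u v"
  using E by (auto simp: adj_def undirected_graph_def)

lemma transpose_Hmat: "transpose (Hmat E) = Hmat E"
  by (simp add: transpose_def Hmat_def laplacian_def Delta_def vec_eq_iff adj_sym)

text \<open>Stated for values in any real vector space: scalars are needed for the quadratic form,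
  vectors for the observer errors.\<close>

lemma Hmat_scaleR_sum:
  "(\<Sum>j\<in>UNIV. Hmat E $ i $ j *\<^sub>R (y j :: 'b::real_vector)) = (\<Sum>j\<in>UNIV. follower_adj i j *\<^sub>R (y i - y j)) + adj E (Some i) None *\<^sub>R y i"
proof -
  have "Hmat E $ i $ j *\<^sub>R y j = (if j = i then ((\<Sum>k\<in>UNIV. follower_adj i k) + adj E (Some i) None) *\<^sub>R y i else 0) - follower_adj i j *\<^sub>R y j" for j
    by (auto simp: Hmat_def laplacian_def Delta_def adj_irrefl)
  then have "(\<Sum>j\<in>UNIV. Hmat E $ i $ j *\<^sub>R y j) =
      ((\<Sum>k\<in>UNIV. follower_adj i k) + adj E (Some i) None) *\<^sub>R y i - (\<Sum>j\<in>UNIV. follower_adj i j *\<^sub>R y j)"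
    by (simp add: sum_subtractf)
  then show ?thesis
    by (simp add: scaleR_diff_right sum_subtractf scaleR_add_left scaleR_sum_left)
qed

text \<open>The Dirichlet energy of the graph plus the pinning to the leader: swapping the roles of
  \<open>i\<close> and \<open>j\<close> and averaging the two sums produces the squares.\<close>

lemma Hmat_quadratic:
  "y \<bullet> (Hmat E *v y) = (\<Sum>i\<in>UNIV. \<Sum>j\<in>UNIV. follower_adj i j * (y $ i - y $ j)\<^sup>2) / 2 + (\<Sum>i\<in>UNIV. adj E (Some i) None * (y $ i)\<^sup>2)"
proof -
  define s where "s = (\<Sum>i\<in>UNIV. \<Sum>j\<in>UNIV. follower_adj i j * (y $ i * (y $ i - y $ j)))"
  have "(Hmat E *v y) $ i = (\<Sum>j\<in>UNIV. follower_adj i j * (y $ i - y $ j)) + adj E (Some i) None * y $ i" for i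
    using Hmat_scaleR_sum[of i "\<lambda>j. y $ j"] by (simp add: matrix_vector_mult_def)
  then have 1: "y \<bullet> (Hmat E *v y) = s + (\<Sum>i\<in>UNIV. adj E (Some i) None * (y $ i)\<^sup>2)"
    by (simp add: inner_vec_def s_def distrib_left sum.distrib sum_distrib_left power2_eq_square mult_ac)
  have "s = (\<Sum>i\<in>UNIV. \<Sum>j\<in>UNIV. follower_adj j i * (y $ j * (y $ j - y $ i)))"
    unfolding s_def by (rule sum.swap)
  also have "\<dots> = (\<Sum>i\<in>UNIV. \<Sum>j\<in>UNIV. follower_adj i j * (y $ j * (y $ j - y $ i)))"
    by (simp add: adj_sym)
  finally have "s + s = (\<Sum>i\<in>UNIV. \<Sum>j\<in>UNIV. follower_adj i j * (y $ i * (y $ i - y $ j)) + follower_adj i j * (y $ j * (y $ j - y $ i)))"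
    by (simp add: s_def sum.distrib)
  also have "\<dots> = (\<Sum>i\<in>UNIV. \<Sum>j\<in>UNIV. follower_adj i j * (y $ i - y $ j)\<^sup>2)"
    by (intro sum.cong refl) (simp add: power2_eq_square algebra_simps)
  finally show ?thesis using 1 by simp
qed

lemma Hmat_psd: "0 \<le> y \<bullet> (Hmat E *v y)"
  unfolding Hmat_quadratic by (intro add_nonneg_nonneg divide_nonneg_pos sum_nonneg mult_nonneg_nonneg adj_nonneg) auto

lemma subspace_ker_Hmat: "subspace {x. Hmat E *v x = 0}"
  by (auto simp: subspace_def matrix_vector_right_distrib matrix_vector_mult_scaleR)

lemma Hmat_mult_Pker: "Hmat E ** Pker E = 0"
  using orth_proj_in[OF subspace_ker_Hmat]
  by (simp add: matrix_eq matrix_vector_mul_assoc[symmetric] Pker_def)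

lemma transpose_Pker: "transpose (Pker E) = Pker E"
  unfolding Pker_def by (rule transpose_orth_proj[OF subspace_ker_Hmat])

text \<open>The transpose of the previous identity. It is the reason why the projected error does
  not feel the gain.\<close>

lemma Pker_mult_Hmat: "Pker E ** Hmat E = 0"
proof -
  have "transpose (Pker E ** Hmat E) = transpose 0"
    by (simp add: matrix_transpose_mul transpose_Pker transpose_Hmat Hmat_mult_Pker) (simp add: transpose_def vec_eq_iff)
  then show ?thesis by simp
qed

text \<open>The form attains its minimum on the unit sphere of the complement of the kernel. A zero
  minimum would put the minimiser into the kernel, hence make it orthogonal to itself.\<close>

lemma Hmat_coercive_orthogonal:
  "\<exists>l>0. \<forall>y. (\<forall>x. Hmat E *v x = 0 \<longrightarrow> x \<bullet> y = 0) \<longrightarrow> l * (norm y)\<^sup>2 \<le> y \<bullet> (Hmat E *v y)"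
proof -
  define T where "T = {y. \<forall>x. Hmat E *v x = 0 \<longrightarrow> x \<bullet> y = 0}"
  define S where "S = sphere 0 1 \<inter> T"
  have T: "y /\<^sub>R c \<in> T" if "y \<in> T" for y c using that by (auto simp: T_def)
  show ?thesis
  proof (cases "S = {}")
    \<comment> \<open>The complement is trivial here, so any positive constant does.\<close>
    case True
    have zero: "y = 0" if "y \<in> T" for y
    proof (rule ccontr)
      assume "y \<noteq> 0"
      then have "y /\<^sub>R norm y \<in> S" using T[OF that] by (simp add: S_def)
      then show False using True by simp
    qed
    have "1 * (norm y)\<^sup>2 \<le> y \<bullet> (Hmat E *v y)" if "y \<in> T" for y
    proof -
      have "y = 0" by (rule zero[OF that])
      then show ?thesis by simp
    qed
    then show ?thesis by (intro exI[of _ 1]) (simp add: T_def)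
  next
    case False
    have "closed T"
    proof -
      have "T = (\<Inter>x\<in>{x. Hmat E *v x = 0}. {y. x \<bullet> y = 0})" by (auto simp: T_def)
      then show ?thesis by (simp add: closed_INT closed_hyperplane)
    qed
    then have "compact S" unfolding S_def by (intro compact_Int_closed) auto
    moreover have "continuous_on S (\<lambda>x. x \<bullet> (Hmat E *v x))"
      by (intro continuous_intros linear_continuous_on matrix_vector_mul_bounded_linear)
    ultimately obtain v where v: "v \<in> S" "\<And>y. y \<in> S \<Longrightarrow> v \<bullet> (Hmat E *v v) \<le> y \<bullet> (Hmat E *v y)"
      using continuous_attains_inf[of S] False by blast
    define l where "l = v \<bullet> (Hmat E *v v)"
    have "l \<noteq> 0"
    proof
      assume "l = 0"
      have "(norm (Hmat E *v v))\<^sup>2 \<le> (norm (Hmat E) + 1) * (v \<bullet> (Hmat E *v v))"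
        by (rule psd_norm_square_le) (use transpose_Hmat Hmat_psd in \<open>auto intro: add_nonneg_pos\<close>)
      then have "Hmat E *v v = 0" using \<open>l = 0\<close> by (simp add: l_def)
      then have "v \<bullet> v = 0" using v(1) by (auto simp: S_def T_def)
      then show False using v(1) by (auto simp: S_def)
    qed
    then have "l > 0" using Hmat_psd[of v] by (simp add: l_def)
    moreover have "l * (norm y)\<^sup>2 \<le> y \<bullet> (Hmat E *v y)" if "y \<in> T" for y
    proof (cases "y = 0")
      case False
      then have "y /\<^sub>R norm y \<in> S" using T[OF that] by (simp add: S_def)
      from v(2)[OF this] have "l \<le> (y \<bullet> (Hmat E *v y)) / (norm y)\<^sup>2"
        by (simp add: l_def matrix_vector_mult_scaleR divide_simps power2_eq_square)
      then show ?thesis using False by (simp add: field_simps)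
    qed simp
    ultimately show ?thesis by (auto simp: T_def)
  qed
qed

lemma Hmat_coercive:
  assumes l: "\<forall>y. (\<forall>x. Hmat E *v x = 0 \<longrightarrow> x \<bullet> y = 0) \<longrightarrow> l * (norm y)\<^sup>2 \<le> y \<bullet> (Hmat E *v y)"
    and Y: "Pker E ** Y = (0 :: real^'p^'N)"
  shows "l * (norm Y)\<^sup>2 \<le> Y \<bullet> (Hmat E ** Y)"
proof -
  have "l * (norm (column k Y))\<^sup>2 \<le> column k Y \<bullet> (Hmat E *v column k Y)" for k
  proof (rule l[rule_format])
    fix x assume x: "Hmat E *v x = 0"
    have "Pker E *v column k Y = 0"
      using column_matrix_mult[of k "Pker E" Y] Y by (simp add: column_def vec_eq_iff)
    then show "x \<bullet> column k Y = 0"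
      using orth_proj_orthogonal[OF subspace_ker_Hmat, of x "column k Y"] x
      by (simp add: Pker_def inner_commute)
  qed
  then show ?thesis
    unfolding norm_matrix_columns matrix_inner_columns column_matrix_mult sum_distrib_left by (rule sum_mono)
qed

end

lemma Hmat_coercive_uniform:
  "\<exists>l>0. \<forall>E::('N::finite option \<times> 'N option) set. undirected_graph E \<longrightarrow>
    (\<forall>y. (\<forall>x. Hmat E *v x = 0 \<longrightarrow> x \<bullet> y = 0) \<longrightarrow> l * (norm y)\<^sup>2 \<le> y \<bullet> (Hmat E *v y))"
proof -
  \<comment> \<open>Positivity is kept outside the implication so that \<open>l\<close> is positive
    at every edge set and its minimum over the finite type of edge sets is positive too.\<close>
  have "\<forall>E::('N option \<times> 'N option) set. \<exists>l>0. undirected_graph E \<longrightarrow>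
    (\<forall>y. (\<forall>x. Hmat E *v x = 0 \<longrightarrow> x \<bullet> y = 0) \<longrightarrow> l * (norm y)\<^sup>2 \<le> y \<bullet> (Hmat E *v y))"
    using Hmat_coercive_orthogonal zero_less_one by blast
  then obtain l :: "('N option \<times> 'N option) set \<Rightarrow> real" where l: "\<And>E. 0 < l E"
    "\<And>E y. undirected_graph E \<Longrightarrow> (\<forall>x. Hmat E *v x = 0 \<longrightarrow> x \<bullet> y = 0) \<Longrightarrow> l E * (norm y)\<^sup>2 \<le> y \<bullet> (Hmat E *v y)"
    by metis
  define m where "m = Min (range l)"
  have "m > 0" using l(1) by (simp add: m_def)
  moreover have "m * (norm y)\<^sup>2 \<le> l E * (norm y)\<^sup>2" for E and y :: "real^'N"
    by (intro mult_right_mono) (auto simp: m_def)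
  ultimately show ?thesis using l(2) by (meson order_trans)
qed

section \<open>Decay off the kernel and the estimate for one switching interval\<close>

lemma row_mult_transpose: "(X ** transpose M) $ i = M *v (X $ i)" for X :: "real^'n^'k" and M :: "real^'n^'m"
  by (simp add: vec_eq_iff matrix_matrix_mult_def matrix_vector_mult_def transpose_def mult.commute)

text \<open>In the derivative of the form the factor \<open>matrix_inv W\<close> of the gain cancels
  against \<open>W\<close>, so the coupling acts through the output error alone. By coercivity and
  \<open>1 \<le> 2 \<kappa> l\<close> it outweighs the output term of the Lyapunov equation, and
  exactly the rate \<open>2 \<gamma>\<close> is left.\<close>

lemma high_gain_decay:
  fixes A :: "real^'n^'n" and C :: "real^'n^'m" and f :: "real \<Rightarrow> real^'n^'N" and H :: "real^'N^'N"
  assumes L: "lyapunov_solution A C \<gamma> W" and lb: "\<And>x. lw * (norm x)\<^sup>2 \<le> x \<bullet> (W *v x)" and lw: "lw > 0"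
    and \<kappa>: "0 \<le> \<kappa>" "1 \<le> 2 * \<kappa> * l"
    and ab: "a \<le> b" and cont: "continuous_on {a..b} f"
    and der: "\<And>t. a \<le> t \<Longrightarrow> t < b \<Longrightarrow> (f has_vector_derivative
      (f t ** transpose A - H ** f t ** transpose ((\<kappa> *\<^sub>R (matrix_inv W ** transpose C)) ** C))) (at t within {t..})"
    and coer: "\<And>t. a \<le> t \<Longrightarrow> t < b \<Longrightarrow>
      l * (norm (f t ** transpose C))\<^sup>2 \<le> (f t ** transpose C) \<bullet> (H ** (f t ** transpose C))"
  shows "lw * (norm (f b))\<^sup>2 \<le> exp (- 2 * \<gamma> * (b - a)) * (norm W * (norm (f a))\<^sup>2)"
proof -
  have sym: "transpose W = W" and eq: "lyapunov_op A \<gamma> W = transpose C ** C"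
    using L by (auto simp: lyapunov_solution_def)
  define V where "V X = X \<bullet> (X ** W)" for X :: "real^'n^'N"
  have rowW: "(X ** W) $ i = W *v (X $ i)" for X :: "real^'n^'N" and i
    using row_mult_transpose[of X W i] sym by simp
  have Vlow: "lw * (norm X)\<^sup>2 \<le> V X" for X
    unfolding V_def inner_vec_def[of X] rowW norm_vec_square[of X] sum_distrib_left by (intro sum_mono lb)
  have Vup: "V X \<le> norm W * (norm X)\<^sup>2" for X
  proof -
    have "V X \<le> norm X * norm (X ** W)" unfolding V_def by (rule norm_cauchy_schwarz)
    also have "\<dots> \<le> norm X * (norm X * norm W)" by (intro mult_left_mono norm_matrix_matrix_mult_le) auto
    finally show ?thesis by (simp add: power2_eq_square mult_ac)
  qed
  \<comment> \<open>The lower bound makes \<open>W\<close> invertible, so that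
    \<open>matrix_inv W\<close> is a genuine inverse.\<close>
  have "W *v x = 0 \<Longrightarrow> x = 0" for x using lb[of x] lw by (simp add: mult_le_0_iff)
  then have "invertible W"
    using matrix_left_invertible_ker invertible_left_inverse by blast
  then have inv: "W ** matrix_inv W = mat 1" unfolding invertible_def matrix_inv_def by (rule someI2_ex) blast
  have der_le: "2 * ((X ** transpose A - H ** X ** transpose ((\<kappa> *\<^sub>R (matrix_inv W ** transpose C)) ** C)) \<bullet> (X ** W))
      \<le> (- 2 * \<gamma>) * V X"
    if coer: "l * (norm (X ** transpose C))\<^sup>2 \<le> (X ** transpose C) \<bullet> (H ** (X ** transpose C))" for X :: "real^'n^'N"
  proof -
    define Y where "Y = X ** transpose C"
    have "(norm Y)\<^sup>2 = (\<Sum>i\<in>UNIV. (C *v X $ i) \<bullet> (C *v X $ i))"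
      by (simp add: Y_def power2_norm_eq_inner inner_vec_def[of "X ** _"] row_mult_transpose)
    also have "\<dots> = 2 * ((X ** transpose A) \<bullet> (X ** W)) + 2 * \<gamma> * V X"
      by (simp add: V_def lyapunov_quadratic[OF eq sym] sum.distrib sum_distrib_left inner_vec_def[of "X ** _"] inner_vec_def[of X] row_mult_transpose rowW)
    finally have 1: "2 * ((X ** transpose A) \<bullet> (X ** W)) = (norm Y)\<^sup>2 - 2 * \<gamma> * V X" by simp
    have "(H ** X ** transpose ((\<kappa> *\<^sub>R (matrix_inv W ** transpose C)) ** C)) =
        \<kappa> *\<^sub>R ((H ** Y) ** C ** transpose (matrix_inv W))"
      by (simp add: Y_def matrix_transpose_mul transpose_scalar matrix_scalar_ac scalar_matrix_assoc[symmetric] matrix_mul_assoc)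
    then have "(H ** X ** transpose ((\<kappa> *\<^sub>R (matrix_inv W ** transpose C)) ** C)) \<bullet> (X ** W) =
        \<kappa> * (((H ** Y) ** C) \<bullet> (X ** (W ** matrix_inv W)))"
      by (simp add: inner_matrix_mult_right[of "H ** Y ** C"] matrix_mul_assoc)
    also have "\<dots> = \<kappa> * (Y \<bullet> (H ** Y))"
      using inner_matrix_mult_right[of "H ** Y" C X] by (simp add: inv Y_def[symmetric] inner_commute[of Y])
    finally have 2: "(H ** X ** transpose ((\<kappa> *\<^sub>R (matrix_inv W ** transpose C)) ** C)) \<bullet> (X ** W) = \<kappa> * (Y \<bullet> (H ** Y))" .
    have "(norm Y)\<^sup>2 \<le> (2 * \<kappa> * l) * (norm Y)\<^sup>2" using mult_right_mono[OF \<kappa>(2), of "(norm Y)\<^sup>2"] by simp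
    also have "\<dots> = 2 * (\<kappa> * (l * (norm Y)\<^sup>2))" by simp
    also have "\<dots> \<le> 2 * (\<kappa> * (Y \<bullet> (H ** Y)))"
      using coer \<kappa>(1) by (intro mult_left_mono) (auto simp: Y_def)
    finally show ?thesis using 1 2 by (simp add: inner_diff_left)
  qed
  have "V (f b) \<le> exp ((- 2 * \<gamma>) * (b - a)) * V (f a)"
  proof (rule right_derivative_exp_bound[OF ab])
    show "continuous_on {a..b} (\<lambda>t. V (f t))" unfolding V_def
      by (intro continuous_intros cont bounded_linear.continuous_on[OF bounded_linear_matrix_mult_right])
    fix t assume t: "a \<le> t" "t < b"
    let ?D = "f t ** transpose A - H ** f t ** transpose ((\<kappa> *\<^sub>R (matrix_inv W ** transpose C)) ** C)"
    have "((\<lambda>t. V (f t)) has_vector_derivative (f t \<bullet> (?D ** W) + ?D \<bullet> (f t ** W))) (at t within {t..})"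
      unfolding V_def by (rule has_vector_derivative_inner[OF der[OF t] has_vector_derivative_matrix_mult_right[OF der[OF t]]])
    moreover have "f t \<bullet> (?D ** W) = ?D \<bullet> (f t ** W)"
      using inner_matrix_mult_right[of ?D W "f t"] sym by (simp add: inner_commute)
    ultimately show "\<exists>D. ((\<lambda>t. V (f t)) has_vector_derivative D) (at t within {t..}) \<and> D \<le> (- 2 * \<gamma>) * V (f t)"
      using der_le[OF coer[OF t]] by (intro exI[of _ "2 * (?D \<bullet> (f t ** W))"]) simp
  qed
  also have "\<dots> \<le> exp ((- 2 * \<gamma>) * (b - a)) * (norm W * (norm (f a))\<^sup>2)"
    by (intro mult_left_mono Vup) simp
  finally show ?thesis using Vlow[of "f b"] by simp
qed

lemma bounded_linear_transpose: "bounded_linear (transpose :: real^'n^'m \<Rightarrow> real^'m^'n)"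
  by (simp add: linear_conv_bounded_linear[symmetric] linear_iff transpose_add transpose_scalar)

text \<open>The error splits into \<open>g = P e\<close>, which follows the free flow exactly
  because \<open>P H = 0\<close>, and \<open>f = e - g\<close>, which stays in the complement and
  decays. The quantity estimated is \<open>f b\<close>. Right multiplication by \<open>C^T\<close>
  preserves \<open>P f = 0\<close>, which makes coercivity applicable to the output error.\<close>

lemma switching_interval_estimate:
  fixes A :: "real^'n^'n" and C :: "real^'n^'m" and e :: "real \<Rightarrow> real^'n^'N"
    and E :: "('N::finite option \<times> 'N option) set"
  assumes E: "undirected_graph E"
    and l: "\<forall>y. (\<forall>x. Hmat E *v x = 0 \<longrightarrow> x \<bullet> y = 0) \<longrightarrow> l * (norm y)\<^sup>2 \<le> y \<bullet> (Hmat E *v y)"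
    and L: "lyapunov_solution A C \<gamma> W" and lb: "\<And>x. exp (- \<gamma> * \<tau>) * (norm x)\<^sup>2 \<le> x \<bullet> (W *v x)"
    and \<kappa>: "0 \<le> \<kappa>" "1 \<le> 2 * \<kappa> * l"
    and ab: "a \<le> b" "\<tau> \<le> b - a" and cont: "continuous_on {a..b} e"
    and der: "\<And>t. a \<le> t \<Longrightarrow> t < b \<Longrightarrow> (e has_vector_derivative
      (e t ** transpose A - Hmat E ** e t ** transpose ((\<kappa> *\<^sub>R (matrix_inv W ** transpose C)) ** C))) (at t within {t..})"
  shows "(norm (e b - Pker E ** e a ** transpose (matrix_exp A (b - a))))\<^sup>2
    \<le> exp (- \<gamma> * \<tau>) * norm (transpose C ** C) * (norm (e a))\<^sup>2"
proof -
  let ?P = "Pker E" and ?K = "transpose ((\<kappa> *\<^sub>R (matrix_inv W ** transpose C)) ** C)"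
  note sub = subspace_ker_Hmat[OF E]
  define g where "g t = ?P ** e t" for t
  define f where "f t = e t - g t" for t
  have contg: "continuous_on {a..b} g" unfolding g_def
    by (rule bounded_linear.continuous_on[OF bounded_linear_matrix_mult_left cont])
  have derg: "(g has_vector_derivative (g t ** transpose A)) (at t within {t..})" if t: "a \<le> t" "t < b" for t
    using has_vector_derivative_matrix_mult_left[OF der[OF t], of ?P]
    unfolding g_def by (simp add: matrix_diff_ldistrib matrix_mul_assoc Pker_mult_Hmat[OF E])
  have gb: "g b = g a ** transpose (matrix_exp A (b - a))"
  proof (rule linear_ode_unique[of "\<lambda>X. X ** transpose A" a b])
    show "linear (\<lambda>X::real^'n^'N. X ** transpose A)"
      by (rule bounded_linear.linear[OF bounded_linear_matrix_mult_right])
    show "continuous_on {a..b} (\<lambda>t. g a ** transpose (matrix_exp A (t - a)))"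
      by (intro bounded_linear.continuous_on[OF bounded_linear_matrix_mult_left]
        bounded_linear.continuous_on[OF bounded_linear_transpose] continuous_on_matrix_exp_shift)
    show "((\<lambda>t. g a ** transpose (matrix_exp A (t - a))) has_vector_derivative
      g a ** transpose (matrix_exp A (t - a)) ** transpose A) (at t within {t..})" for t
      using has_vector_derivative_matrix_mult_left[OF bounded_linear.has_vector_derivative[OF bounded_linear_transpose
        has_vector_derivative_matrix_exp_shift[of A a t "{t..}"]], of "g a"]
      by (simp add: matrix_transpose_mul matrix_mul_assoc)
  qed (use ab contg derg in \<open>auto simp: matrix_exp_0\<close>)
  have Hg: "Hmat E ** g t = 0" for t by (simp add: g_def matrix_mul_assoc Hmat_mult_Pker[OF E])
  have Pf: "?P ** f t = 0" for t
    using orth_proj_idem[OF sub] by (simp add: f_def g_def matrix_diff_ldistrib matrix_mul_assoc Pker_def)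
  have "exp (- \<gamma> * \<tau>) * (norm (f b))\<^sup>2 \<le> exp (- 2 * \<gamma> * (b - a)) * (norm W * (norm (f a))\<^sup>2)"
  proof (rule high_gain_decay[OF L lb _ \<kappa> ab(1)])
    show "continuous_on {a..b} f" unfolding f_def by (intro continuous_intros cont contg)
    fix t assume t: "a \<le> t" "t < b"
    show "(f has_vector_derivative (f t ** transpose A - Hmat E ** f t ** ?K)) (at t within {t..})"
      unfolding f_def using has_vector_derivative_diff[OF der[OF t] derg[OF t]]
      by (simp add: matrix_diff_ldistrib matrix_diff_rdistrib Hg algebra_simps)
    show "l * (norm (f t ** transpose C))\<^sup>2 \<le> (f t ** transpose C) \<bullet> (Hmat E ** (f t ** transpose C))"
      by (rule Hmat_coercive[OF E l]) (simp add: matrix_mul_assoc Pf)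
  qed simp
  also have "\<dots> \<le> exp (- 2 * \<gamma> * \<tau>) * (norm (transpose C ** C) * (norm (e a))\<^sup>2)"
  proof (intro mult_mono power_mono)
    have "0 \<le> \<gamma>" using L norm_ge_zero[of A] unfolding lyapunov_solution_def by linarith
    then show "exp (- 2 * \<gamma> * (b - a)) \<le> exp (- 2 * \<gamma> * \<tau>)" using ab by (simp add: mult_left_mono)
    show "norm W \<le> norm (transpose C ** C)" using L by (simp add: lyapunov_solution_def)
    have "f a = (mat 1 - ?P) ** e a" by (simp add: f_def g_def matrix_diff_rdistrib)
    moreover have "norm ((mat 1 - ?P) ** e a) \<le> 1 * norm (e a)"
      by (rule norm_matrix_mult_columnwise_le)
        (simp_all add: matrix_vector_mult_diff_rdistrib Pker_def norm_orth_proj_complement_le[OF sub])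
    ultimately show "norm (f a) \<le> norm (e a)" by simp
  qed auto
  \<comment> \<open>One of the two factors cancels against the lower bound of \<open>W\<close>; the
    other remains as the gain in smallness.\<close>
  also have "exp (- 2 * \<gamma> * \<tau>) = exp (- \<gamma> * \<tau>) * exp (- \<gamma> * \<tau>)" by (simp add: exp_add[symmetric])
  finally have "(norm (f b))\<^sup>2 \<le> exp (- \<gamma> * \<tau>) * norm (transpose C ** C) * (norm (e a))\<^sup>2"
    by (simp add: mult.assoc)
  moreover have "f b = e b - Pker E ** e a ** transpose (matrix_exp A (b - a))"
    by (simp add: f_def gb) (simp add: g_def)
  ultimately show ?thesis by simp
qed

section \<open>Products over switching intervals\<close>

lemma ordprod_refl: "ordprod P m m = mat 1"
  by (simp add: ordprod_def)

lemma ordprod_Suc: "m \<le> n \<Longrightarrow> ordprod P m (Suc n) = P n ** ordprod P m n"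
  by (simp add: ordprod_def)

lemma ordprod_append:
  assumes "a \<le> b" "b \<le> c"
  shows "ordprod P a c = ordprod P b c ** ordprod P a b"
  using assms(2)
proof (induction c rule: dec_induct)
  case (step n)
  then show ?case using assms(1) by (simp add: ordprod_Suc matrix_mul_assoc)
qed (simp add: ordprod_refl)

lemma ordprod_cycles_le:
  fixes X :: "real^'p^'N"
  assumes "mono jk" "0 \<le> \<delta>" and bd: "\<And>k. induced_norm (ordprod P (jk k) (jk (Suc k))) \<le> \<delta>"
  shows "norm (ordprod P (jk k) (jk (k + K)) ** X) \<le> \<delta> ^ K * norm X"
proof (induction K)
  case (Suc K)
  have "ordprod P (jk k) (jk (k + Suc K)) = ordprod P (jk (k + K)) (jk (Suc (k + K))) ** ordprod P (jk k) (jk (k + K))"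
    using assms(1) by (subst ordprod_append[of _ "jk (k + K)"]) (auto simp: mono_def)
  then have "norm (ordprod P (jk k) (jk (k + Suc K)) ** X) \<le>
      induced_norm (ordprod P (jk (k + K)) (jk (Suc (k + K)))) * norm (ordprod P (jk k) (jk (k + K)) ** X)"
    using norm_matrix_mult_induced_norm by (metis matrix_mul_assoc)
  also have "\<dots> \<le> \<delta> * (\<delta> ^ K * norm X)"
    using assms(2) by (intro mult_mono bd Suc.IH) auto
  finally show ?case by (simp add: mult_ac)
qed (simp add: ordprod_refl)

text \<open>Projections act from the left and exponentials from the right, so the ideal transitions
  compose to one ordered product and one exponential of the total time. The two bounds are proved
  together because each new local error is measured by the current size of \<open>e\<close>;
  \<open>\<epsilon> \<le> 1\<close> lets \<open>B + 1\<close> bound the growth per step.\<close>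

lemma perturbed_product_estimate:
  fixes e :: "nat \<Rightarrow> real^'n^'N" and A :: "real^'n^'n"
  assumes step: "\<And>j. norm (e (Suc j) - P j ** e j ** transpose (matrix_exp A (t (Suc j) - t j))) \<le> \<epsilon> * norm (e j)"
    and P: "\<And>j (X::real^'n^'N). norm (P j ** X) \<le> norm X"
    and B: "\<And>j. norm (matrix_exp A (t (Suc j) - t j)) \<le> B" "1 \<le> B"
    and \<epsilon>: "0 \<le> \<epsilon>" "\<epsilon> \<le> 1" and mono: "\<And>j. t j \<le> t (Suc j)"
  shows "norm (e (a + i)) \<le> (B + 1) ^ i * norm (e a) \<and>
    norm (e (a + i) - ordprod P a (a + i) ** e a ** transpose (matrix_exp A (t (a + i) - t a)))
      \<le> \<epsilon> * i * (B + 1) ^ i * norm (e a)"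
proof (induction i)
  case 0
  show ?case by (simp add: ordprod_refl matrix_exp_0)
next
  case (Suc i)
  let ?S = "\<lambda>X. P (a + i) ** X ** transpose (matrix_exp A (t (Suc (a + i)) - t (a + i)))"
  have S: "norm (?S X) \<le> B * norm X" for X
  proof -
    have "norm (?S X) \<le> norm (P (a + i) ** X) * norm (matrix_exp A (t (Suc (a + i)) - t (a + i)))"
      by (metis norm_matrix_matrix_mult_le norm_transpose)
    also have "\<dots> \<le> norm X * B" using B by (intro mult_mono P) auto
    finally show ?thesis by (simp add: mult.commute)
  qed
  define Z where "Z = ordprod P a (a + i) ** e a ** transpose (matrix_exp A (t (a + i) - t a))"
  have IH: "norm (e (a + i)) \<le> (B + 1) ^ i * norm (e a)" "norm (e (a + i) - Z) \<le> \<epsilon> * i * (B + 1) ^ i * norm (e a)"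
    using Suc by (auto simp: Z_def)
  have SZ: "ordprod P a (a + Suc i) ** e a ** transpose (matrix_exp A (t (a + Suc i) - t a)) = ?S Z"
  proof -
    have "matrix_exp A ((t (Suc (a + i)) - t (a + i)) + (t (a + i) - t a)) =
        matrix_exp A (t (Suc (a + i)) - t (a + i)) ** matrix_exp A (t (a + i) - t a)"
      by (rule matrix_exp_add) (use mono in simp)
    then have "matrix_exp A (t (a + Suc i) - t a) = matrix_exp A (t (Suc (a + i)) - t (a + i)) ** matrix_exp A (t (a + i) - t a)"
      by simp
    then show ?thesis by (simp add: Z_def ordprod_Suc matrix_transpose_mul matrix_mul_assoc)
  qed
  note st = step[of "a + i"]
  have "e (Suc (a + i)) = ?S (e (a + i)) + (e (Suc (a + i)) - ?S (e (a + i)))" by simp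
  then have "norm (e (Suc (a + i))) \<le> norm (?S (e (a + i))) + norm (e (Suc (a + i)) - ?S (e (a + i)))"
    by (metis norm_triangle_ineq)
  also have "\<dots> \<le> B * norm (e (a + i)) + \<epsilon> * norm (e (a + i))" by (intro add_mono S st)
  also have "\<dots> \<le> (B + 1) * norm (e (a + i))" using \<epsilon> mult_right_mono[OF \<epsilon>(2) norm_ge_zero[of "e (a + i)"]] by (simp add: algebra_simps)
  also have "\<dots> \<le> (B + 1) * ((B + 1) ^ i * norm (e a))" using B IH by (intro mult_left_mono) auto
  finally have 1: "norm (e (a + Suc i)) \<le> (B + 1) ^ Suc i * norm (e a)" by (simp add: mult_ac)
  have "?S (e (a + i)) - ?S Z = ?S (e (a + i) - Z)"
    by (simp add: matrix_diff_ldistrib matrix_diff_rdistrib)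
  then have "e (Suc (a + i)) - ?S Z = ?S (e (a + i) - Z) + (e (Suc (a + i)) - ?S (e (a + i)))"
    by (simp add: algebra_simps)
  then have "norm (e (Suc (a + i)) - ?S Z) \<le> norm (?S (e (a + i) - Z)) + norm (e (Suc (a + i)) - ?S (e (a + i)))"
    by (metis norm_triangle_ineq)
  also have "\<dots> \<le> B * norm (e (a + i) - Z) + \<epsilon> * norm (e (a + i))" by (intro add_mono S st)
  also have "\<dots> \<le> B * (\<epsilon> * i * (B + 1) ^ i * norm (e a)) + \<epsilon> * ((B + 1) ^ i * norm (e a))"
    using B \<epsilon> by (intro add_mono mult_left_mono IH) auto
  also have "\<dots> = (B * i + 1) * (\<epsilon> * ((B + 1) ^ i * norm (e a)))" by (simp add: algebra_simps)
  also have "\<dots> \<le> ((B + 1) * (i + 1)) * (\<epsilon> * ((B + 1) ^ i * norm (e a)))"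
    using B \<epsilon> by (intro mult_right_mono) (auto simp: algebra_simps)
  finally have "norm (e (a + Suc i) - ?S Z) \<le> \<epsilon> * real (Suc i) * (B + 1) ^ Suc i * norm (e a)"
    by (simp add: mult_ac add.commute)
  then show ?case using 1 SZ by simp
qed

text \<open>Halving at least once per time \<open>\<Theta>\<close> gives the rate
  \<open>ln 2 / \<Theta>\<close>. Between the sampling times the growth bound costs the constant
  \<open>exp (\<beta> \<Theta>)\<close>.\<close>

lemma exponential_decay_from_contraction:
  fixes y :: "real \<Rightarrow> 'a::real_normed_vector"
  assumes T0: "T 0 = 0" and gap: "\<And>q. T (Suc q) - T q \<le> \<Theta>" and \<Theta>: "0 < \<Theta>"
    and unb: "\<And>s. \<exists>q. s < T q"
    and half: "\<And>q. norm (y (T (Suc q))) \<le> 1 / 2 * norm (y (T q))"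
    and growth: "\<And>r s. 0 \<le> r \<Longrightarrow> r \<le> s \<Longrightarrow> norm (y s) \<le> exp (\<beta> * (s - r)) * norm (y r)" and \<beta>: "0 \<le> \<beta>"
    and T_nonneg: "\<And>q. 0 \<le> T q"
  shows "\<exists>c \<alpha>. \<alpha> > 0 \<and> (\<forall>s\<ge>0. norm (y s) \<le> c * exp (- \<alpha> * s))"
proof -
  define \<alpha> where "\<alpha> = ln 2 / \<Theta>"
  have \<alpha>: "\<alpha> > 0" using \<Theta> by (simp add: \<alpha>_def)
  have yT: "norm (y (T q)) \<le> (1 / 2) ^ q * norm (y 0)" for q
  proof (induction q)
    case (Suc q)
    then show ?case using half[of q] by simp
  qed (simp add: T0)
  have TT: "T q \<le> q * \<Theta>" for q
  proof (induction q)
    case (Suc q)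
    then show ?case using gap[of q] by (simp add: algebra_simps)
  qed (simp add: T0)
  have "norm (y s) \<le> (2 * exp (\<beta> * \<Theta>) * norm (y 0)) * exp (- \<alpha> * s)" if s: "s \<ge> 0" for s
  proof -
    define p where "p = (LEAST p. s < T p)"
    have p: "s < T p" unfolding p_def by (rule LeastI_ex[OF unb])
    have "p \<noteq> 0" using p s T0 by (metis not_less)
    then obtain q where q: "p = Suc q" using not0_implies_Suc by blast
    have "\<not> s < T q" using not_less_Least[of q "\<lambda>p. s < T p"] q by (simp add: p_def[symmetric])
    then have Tq: "T q \<le> s" by simp
    \<comment> \<open>Time is compared with the next sample \<open>Suc q\<close>, while only
      \<open>q\<close> halvings have taken place; this is the origin of the factor 2 in the
      constant.\<close>
    have "s \<le> Suc q * \<Theta>" using p TT[of p] unfolding q by linarith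
    then have "s / \<Theta> \<le> Suc q" using \<Theta> by (simp only: pos_divide_le_eq)
    then have "s / \<Theta> * ln 2 \<le> Suc q * ln 2" by (rule mult_right_mono) simp
    then have "\<alpha> * s \<le> Suc q * ln 2" by (simp add: \<alpha>_def mult.commute)
    then have "exp (- (Suc q * ln 2)) \<le> exp (- \<alpha> * s)" by simp
    moreover have "exp (- (Suc q * ln 2)) = (1 / 2 :: real) ^ Suc q"
      by (simp only: exp_minus exp_of_nat_mult) (simp add: power_one_over inverse_eq_divide)
    ultimately have "(1 / 2) ^ Suc q \<le> exp (- \<alpha> * s)" by (simp only:)
    then have half_le: "(1 / 2 :: real) ^ q \<le> 2 * exp (- \<alpha> * s)" by simp
    have "norm (y s) \<le> exp (\<beta> * (s - T q)) * norm (y (T q))" by (rule growth[OF T_nonneg Tq])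
    also have "\<dots> \<le> exp (\<beta> * \<Theta>) * ((1 / 2) ^ q * norm (y 0))"
    proof (intro mult_mono yT)
      have "s - T q \<le> \<Theta>" using p gap[of q] by (simp add: q)
      then show "exp (\<beta> * (s - T q)) \<le> exp (\<beta> * \<Theta>)" using \<beta> by (simp add: mult_left_mono)
    qed auto
    also have "\<dots> \<le> exp (\<beta> * \<Theta>) * ((2 * exp (- \<alpha> * s)) * norm (y 0))"
      by (intro mult_left_mono mult_right_mono half_le) auto
    finally show ?thesis by (simp add: mult_ac)
  qed
  then show ?thesis using \<alpha> by blast
qed

section \<open>Switching times and solutions glued across the switches\<close>

context
  fixes t :: "nat \<Rightarrow> real" and \<tau> :: real
  assumes t0: "t 0 = 0" and \<tau>: "0 < \<tau>" and dwell: "\<And>j. t (Suc j) - t j \<ge> \<tau>"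
begin

lemma switching_times_strict_mono: "strict_mono t"
  using dwell \<tau> by (intro strict_monoI_Suc) (metis add.commute diff_gt_0_iff_gt less_le_trans)

lemma switching_times_gap: "i \<le> j \<Longrightarrow> real (j - i) * \<tau> \<le> t j - t i"
proof (induction j rule: dec_induct)
  case (step n)
  then show ?case using dwell[of n] by (simp add: Suc_diff_le algebra_simps)
qed simp

lemma switching_times_unbounded: "\<exists>j. s < t j"
proof -
  obtain j :: nat where "s < real j * \<tau>" using \<tau> reals_Archimedean3 by blast
  then show ?thesis using switching_times_gap[of 0 j] t0 by (intro exI[of _ j]) simp
qed

lemma switching_interval_exists:
  assumes "0 \<le> s"
  shows "\<exists>j. t j \<le> s \<and> s < t (Suc j)"
proof -
  define p where "p = (LEAST p. s < t p)"
  have p: "s < t p" unfolding p_def by (rule LeastI_ex[OF switching_times_unbounded])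
  have "p \<noteq> 0" using p assms t0 by (metis not_less)
  then obtain q where q: "p = Suc q" using not0_implies_Suc by blast
  have "\<not> s < t q" using not_less_Least[of q "\<lambda>p. s < t p"] q by (simp add: p_def[symmetric])
  then show ?thesis using p q by (intro exI[of _ q]) simp
qed

lemma switching_interval_unique:
  assumes "t j \<le> s" "s < t (Suc j)" "t i \<le> s" "s < t (Suc i)"
  shows "i = j"
proof -
  have "t i < t (Suc j)" "t j < t (Suc i)" using assms by linarith+
  then show ?thesis using strict_mono_less[OF switching_times_strict_mono] by simp
qed

text \<open>The flows of the successive intervals are glued, \<open>v j\<close> being the state
  reached at \<open>t j\<close>. Since derivatives are taken from the right, each time sees only the
  flow of its own half-open interval.\<close>

lemma switched_linear_ode_exists:
  fixes F :: "nat \<Rightarrow> 'a::euclidean_space \<Rightarrow> 'a"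
  assumes F: "\<And>j. linear (F j)"
  shows "\<exists>e. e 0 = x \<and> continuous_on {0..} e \<and>
    (\<forall>j s. t j \<le> s \<longrightarrow> s < t (Suc j) \<longrightarrow> (e has_vector_derivative F j (e s)) (at s within {s..}))"
proof -
  obtain \<phi> where \<phi>0: "\<And>j v. \<phi> j v 0 = v"
    and \<phi>': "\<And>j v s. (\<phi> j v has_vector_derivative F j (\<phi> j v s)) (at s)"
  proof -
    have "\<forall>j v. \<exists>\<phi>. \<phi> 0 = v \<and> (\<forall>s. (\<phi> has_vector_derivative F j (\<phi> s)) (at s))"
      using linear_ode_exists[OF F] by blast
    then have "\<exists>\<phi>. \<forall>j v. \<phi> j v 0 = v \<and> (\<forall>s. (\<phi> j v has_vector_derivative F j (\<phi> j v s)) (at s))"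
      by (simp only: choice_iff)
    then show ?thesis using that by blast
  qed
  define v where "v = rec_nat x (\<lambda>j u. \<phi> j u (t (Suc j) - t j))"
  have v0: "v 0 = x" and vSuc: "v (Suc j) = \<phi> j (v j) (t (Suc j) - t j)" for j
    by (simp_all add: v_def)
  define idx where "idx s = (SOME j. t j \<le> s \<and> s < t (Suc j))" for s
  have idx: "idx s = j" if "t j \<le> s" "s < t (Suc j)" for j s
  proof -
    have "t (idx s) \<le> s \<and> s < t (Suc (idx s))" unfolding idx_def by (rule someI) (use that in simp)
    then show ?thesis using switching_interval_unique that by blast
  qed
  define e where "e s = \<phi> (idx s) (v (idx s)) (s - t (idx s))" for s
  \<comment> \<open>The right endpoint is included: there \<open>idx\<close> has already moved on,
    but the new flow at elapsed time 0 equals the end value of the old one. This is what makes the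
    glued curve continuous.\<close>
  have e_eq: "e s = \<phi> j (v j) (s - t j)" if "t j \<le> s" "s \<le> t (Suc j)" for j s
  proof (cases "s = t (Suc j)")
    case True
    have "t (Suc j) < t (Suc (Suc j))" using switching_times_strict_mono by (simp add: strict_mono_less)
    then have "idx s = Suc j" using True by (intro idx) auto
    then show ?thesis by (simp add: e_def \<phi>0 True vSuc)
  next
    case False
    then have "idx s = j" using that by (intro idx) auto
    then show ?thesis by (simp add: e_def)
  qed
  have der: "((\<lambda>s. \<phi> j (v j) (s - t j)) has_vector_derivative F j (\<phi> j (v j) (s - t j))) (at s within S)" for j s S
  proof -
    have "((\<lambda>s. s - t j) has_vector_derivative 1) (at s within S)" by (auto intro!: derivative_eq_intros)
    from vector_diff_chain_within[OF this has_vector_derivative_at_within[OF \<phi>']]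
    show ?thesis by (simp add: o_def)
  qed
  have "(e has_vector_derivative F j (e s)) (at s within {s..})" if s: "t j \<le> s" "s < t (Suc j)" for j s
  proof -
    have "((\<lambda>s. \<phi> j (v j) (s - t j)) has_vector_derivative F j (e s)) (at s within {s..})"
      using der[of j s] e_eq[of j s] s by simp
    then show ?thesis
    proof (rule has_vector_derivative_transform_within)
      show "0 < t (Suc j) - s" using s by simp
      show "\<phi> j (v j) (r - t j) = e r" if "r \<in> {s..}" "dist r s < t (Suc j) - s" for r
        using e_eq[of j r] s that by (auto simp: dist_real_def)
    qed simp
  qed
  moreover have "continuous_on {0..} e"
  proof -
    have piece: "continuous_on {t j..t (Suc j)} e" for j
      using continuous_on_vector_derivative[OF der, of "{t j..t (Suc j)}" j]
      by (subst continuous_on_cong[OF refl e_eq]) auto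
    have upto: "continuous_on {0..t j} e" for j
    proof (induction j)
      case (Suc j)
      have "0 \<le> t j" "t j \<le> t (Suc j)"
        using switching_times_strict_mono t0 by (metis strict_mono_less_eq le0, simp add: strict_mono_less_eq)
      then have "{0..t (Suc j)} = {0..t j} \<union> {t j..t (Suc j)}" by auto
      then show ?case using continuous_on_closed_Un[OF _ _ Suc piece] by simp
    qed (simp add: t0)
    show ?thesis unfolding continuous_on_eq_continuous_within
    proof
      fix s :: real assume "s \<in> {0..}"
      obtain j where j: "s < t j" using switching_times_unbounded by blast
      have "continuous (at s within {0..t j}) e"
        using upto[of j] \<open>s \<in> {0..}\<close> j by (simp add: continuous_on_eq_continuous_within)
      moreover have "at s within {0..} = at s within {0..t j}"
        by (rule at_within_nhd[of s "{..<t j}"]) (use j in auto)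
      ultimately show "continuous (at s within {0..}) e" by simp
    qed
  qed
  moreover have "e 0 = x" using e_eq[of 0 0] t0 dwell[of 0] \<tau> by (simp add: \<phi>0 v0)
  ultimately show ?thesis by blast
qed

end

section \<open>From the observer to the matrix error equation; choice of the gain and of the
  constants\<close>

lemma has_vector_derivative_vec_lambda:
  fixes f :: "'N::finite \<Rightarrow> real \<Rightarrow> 'a::euclidean_space"
  assumes "\<And>i. (f i has_vector_derivative f' i) F"
  shows "((\<lambda>t. \<chi> i. f i t) has_vector_derivative (\<chi> i. f' i)) F"
proof -
  have bl: "bounded_linear (axis i :: 'a \<Rightarrow> 'a^'N)" for i
    unfolding linear_conv_bounded_linear[symmetric] by (rule linearI) (simp_all add: axis_def vec_eq_iff)
  have eq: "(\<chi> i. g i) = (\<Sum>i\<in>UNIV. axis i (g i))" for g :: "'N \<Rightarrow> 'a"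
    by (simp add: vec_eq_iff axis_def sum.delta')
  show ?thesis unfolding eq
    by (intro has_vector_derivative_sum bounded_linear.has_vector_derivative[OF bl] assms)
qed

text \<open>The coupling sees only differences of states, so the leader's state cancels and the sum
  is minus a row of \<open>H e\<close>. Splitting off \<open>A x\<close> makes the identity usable
  both for constructing solutions and for analysing given ones.\<close>

lemma error_dynamics:
  fixes A K :: "real^'n^'n" and E :: "('N::finite option \<times> 'N option) set" and \<eta> :: "'N \<Rightarrow> real^'n" and x :: "real^'n"
  assumes E: "undirected_graph E"
  defines "e \<equiv> \<chi> i. \<eta> i - x"
  shows "A *v \<eta> i + K *v (\<Sum>j\<in>UNIV. adj E (Some i) j *\<^sub>R ((case j of None \<Rightarrow> x | Some j' \<Rightarrow> \<eta> j') - \<eta> i))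
    = A *v x + (e ** transpose A - Hmat E ** e ** transpose K) $ i"
proof -
  have "(Hmat E ** e) $ i = (\<Sum>j\<in>UNIV. Hmat E $ i $ j *\<^sub>R e $ j)"
    by (simp add: vec_eq_iff matrix_matrix_mult_def)
  also have "\<dots> = (\<Sum>j\<in>UNIV. adj E (Some i) (Some j) *\<^sub>R (e $ i - e $ j)) + adj E (Some i) None *\<^sub>R e $ i"
    by (rule Hmat_scaleR_sum[OF E])
  finally have H: "(Hmat E ** e) $ i = (\<Sum>j\<in>UNIV. adj E (Some i) (Some j) *\<^sub>R (\<eta> i - \<eta> j)) + adj E (Some i) None *\<^sub>R (\<eta> i - x)"
    by (simp add: e_def)
  have "(\<Sum>j\<in>UNIV. adj E (Some i) j *\<^sub>R ((case j of None \<Rightarrow> x | Some j' \<Rightarrow> \<eta> j') - \<eta> i)) =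
      adj E (Some i) None *\<^sub>R (x - \<eta> i) + (\<Sum>j\<in>UNIV. adj E (Some i) (Some j) *\<^sub>R (\<eta> j - \<eta> i))"
    by (simp add: UNIV_option_conv sum.reindex)
  also have "\<dots> = - ((Hmat E ** e) $ i)"
    unfolding H by (simp add: sum_negf[symmetric] scaleR_diff_right)
  finally have S: "(\<Sum>j\<in>UNIV. adj E (Some i) j *\<^sub>R ((case j of None \<Rightarrow> x | Some j' \<Rightarrow> \<eta> j') - \<eta> i)) = - ((Hmat E ** e) $ i)" .
  have "A *v \<eta> i = A *v x + A *v (e $ i)"
    by (simp add: e_def matrix_vector_mult_diff_distrib)
  moreover have "K *v (- ((Hmat E ** e) $ i)) = - (K *v ((Hmat E ** e) $ i))"
    by (simp add: linear_neg[OF matrix_vector_mul_linear])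
  ultimately show ?thesis unfolding S by (simp add: row_mult_transpose)
qed

lemma Pker_contraction:
  fixes X :: "real^'p^'N::finite"
  assumes "undirected_graph E"
  shows "norm (Pker E ** X) \<le> norm X"
  using norm_matrix_mult_columnwise_le[of "Pker E" 1 X] norm_orth_proj_le[OF subspace_ker_Hmat[OF assms]]
  by (simp add: Pker_def)

text \<open>The order of quantifiers is the point: one \<open>L\<close>, depending on the dwell time
  and \<open>\<epsilon>\<close>, serves all undirected graphs, intervals and solutions.\<close>

lemma high_gain_exists:
  fixes A :: "real^'n^'n" and C :: "real^'n^'m"
  assumes obs: "observable C A" and \<tau>: "0 < \<tau>" and \<epsilon>: "0 < \<epsilon>"
  shows "\<exists>L :: real^'m^'n. \<forall>(E :: ('N::finite option \<times> 'N option) set) (e :: real \<Rightarrow> real^'n^'N) a b.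
    undirected_graph E \<longrightarrow> \<tau> \<le> b - a \<longrightarrow> continuous_on {a..b} e \<longrightarrow>
    (\<forall>s. a \<le> s \<longrightarrow> s < b \<longrightarrow> (e has_vector_derivative
      (e s ** transpose A - Hmat E ** e s ** transpose (L ** C))) (at s within {s..})) \<longrightarrow>
    norm (e b - Pker E ** e a ** transpose (matrix_exp A (b - a))) \<le> \<epsilon> * norm (e a)"
proof -
  obtain l where l: "l > 0" "\<And>E::('N option \<times> 'N option) set. undirected_graph E \<Longrightarrow>
    (\<forall>y. (\<forall>x. Hmat E *v x = 0 \<longrightarrow> x \<bullet> y = 0) \<longrightarrow> l * (norm y)\<^sup>2 \<le> y \<bullet> (Hmat E *v y))"
    using Hmat_coercive_uniform by metis
  let ?c = "norm (transpose C ** C)"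
  have "((\<lambda>\<gamma>. exp (- \<gamma> * \<tau>) * ?c) \<longlongrightarrow> 0 * ?c) at_top"
  proof (intro tendsto_mult_right filterlim_compose[OF exp_at_bot])
    show "filterlim (\<lambda>\<gamma>. - \<gamma> * \<tau>) at_bot at_top"
      using filterlim_tendsto_neg_mult_at_bot[OF tendsto_const[of "- \<tau>"] _ filterlim_ident] \<tau>
      by (simp add: mult.commute)
  qed
  then have small: "\<forall>\<^sub>F \<gamma> in at_top. exp (- \<gamma> * \<tau>) * ?c < \<epsilon>\<^sup>2"
    by (rule order_tendstoD(2)) (use \<epsilon> in simp)
  have "\<forall>\<^sub>F \<gamma> in at_top. norm A + 1 \<le> \<gamma> \<and> exp (- \<gamma> * \<tau>) * ?c < \<epsilon>\<^sup>2 \<and> (\<forall>W. lyapunov_solution A C \<gamma> W \<longrightarrow>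
    (\<forall>x. exp (- \<gamma> * \<tau>) * (norm x)\<^sup>2 \<le> x \<bullet> (W *v x)))"
    by (intro eventually_conj eventually_ge_at_top small lyapunov_eventually_lower_bound[OF obs \<tau>])
  then obtain \<gamma> where \<gamma>: "norm A + 1 \<le> \<gamma>" "exp (- \<gamma> * \<tau>) * ?c < \<epsilon>\<^sup>2"
    and low: "\<And>W x. lyapunov_solution A C \<gamma> W \<Longrightarrow> exp (- \<gamma> * \<tau>) * (norm x)\<^sup>2 \<le> x \<bullet> (W *v x)"
    unfolding eventually_at_top_linorder by blast
  obtain W where W: "lyapunov_solution A C \<gamma> W"
    using lyapunov_solution_exists[OF \<gamma>(1)] \<gamma>(1) unfolding lyapunov_solution_def by blast
  \<comment> \<open>The smallest value for which coercivity compensates the output term of the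
    Lyapunov equation.\<close>
  define \<kappa> where "\<kappa> = 1 / (2 * l)"
  have \<kappa>: "0 \<le> \<kappa>" "1 \<le> 2 * \<kappa> * l" using l(1) by (simp_all add: \<kappa>_def)
  show ?thesis
  proof (intro exI[of _ "\<kappa> *\<^sub>R (matrix_inv W ** transpose C)"] allI impI)
    fix E :: "('N option \<times> 'N option) set" and e :: "real \<Rightarrow> real^'n^'N" and a b
    assume E: "undirected_graph E" and ab: "\<tau> \<le> b - a" and cont: "continuous_on {a..b} e"
      and der: "\<forall>s. a \<le> s \<longrightarrow> s < b \<longrightarrow> (e has_vector_derivative
        (e s ** transpose A - Hmat E ** e s ** transpose ((\<kappa> *\<^sub>R (matrix_inv W ** transpose C)) ** C))) (at s within {s..})"
    have "(norm (e b - Pker E ** e a ** transpose (matrix_exp A (b - a))))\<^sup>2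
        \<le> exp (- \<gamma> * \<tau>) * ?c * (norm (e a))\<^sup>2"
      by (rule switching_interval_estimate[OF E l(2)[OF E] W low[OF W] \<kappa> _ ab cont]) (use ab \<tau> der in auto)
    also have "\<dots> \<le> \<epsilon>\<^sup>2 * (norm (e a))\<^sup>2" using \<gamma>(2) by (intro mult_right_mono) auto
    finally have "(norm (e b - Pker E ** e a ** transpose (matrix_exp A (b - a))))\<^sup>2 \<le> (\<epsilon> * norm (e a))\<^sup>2"
      by (simp add: power_mult_distrib)
    then show "norm (e b - Pker E ** e a ** transpose (matrix_exp A (b - a))) \<le> \<epsilon> * norm (e a)"
      by (rule power2_le_imp_le) (use \<epsilon> in simp)
  qed
qed

theorem theorem2:
  fixes A :: "real^'n^'n" and C :: "real^'n^'m"
    and E :: "nat \<Rightarrow> ('N::finite option \<times> 'N option) set"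
    and n0 :: nat and \<sigma> :: "real \<Rightarrow> nat" and t :: "nat \<Rightarrow> real" and \<tau> :: real
    and jk :: "nat \<Rightarrow> nat" and Tc :: real and \<delta> :: real
  assumes obs: "observable C A"
    and E_irrefl: "\<forall>p. \<forall>(a, b)\<in>E p. a \<noteq> b"
    and sig_range: "\<forall>s\<ge>0. \<sigma> s \<in> {1..n0}"
    and tau_pos: "\<tau> > 0"
    and t0: "t 0 = 0"
    and dwell: "\<forall>j. t (Suc j) - t j \<ge> \<tau>"
    and pw_const: "\<forall>j. \<forall>s\<in>{t j..<t (Suc j)}. \<sigma> s = \<sigma> (t j)"
    and undirected: "\<forall>s\<ge>0. \<forall>i j::'N. (Some i, Some j) \<in> E (\<sigma> s) \<longleftrightarrow> (Some j, Some i) \<in> E (\<sigma> s)"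
    and Tc_pos: "Tc > 0"
    and jk_mono: "strict_mono jk"
    and jk0: "jk 0 = 0"
    and jk_gap: "\<forall>k. t (jk (Suc k)) - t (jk k) \<le> Tc"
    and reach: "\<forall>k. \<forall>i::'N. (None, Some i) \<in> (\<Union>j\<in>{jk k..<jk (Suc k)}. E (\<sigma> (t j)))\<^sup>+"
    and delta: "0 < \<delta>" "\<delta> < 1"
    and prod_bound: "\<forall>k. induced_norm (ordprod (\<lambda>r. Pker (E (\<sigma> (t r)))) (jk k) (jk (Suc k))) \<le> \<delta>"
    and eig: "lambda_max A < - ln \<delta> / Tc"
  shows "\<exists>L :: real^'m^'n. \<forall>(x00 :: real^'n) (eta0 :: 'N \<Rightarrow> real^'n).
           (\<exists>x0 eta. is_solution A (L ** C) (\<lambda>s. E (\<sigma> s)) x0 eta \<and> x0 0 = x00 \<and> (\<forall>i. eta i 0 = eta0 i)) \<and>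
           (\<forall>x0 eta. is_solution A (L ** C) (\<lambda>s. E (\<sigma> s)) x0 eta \<and> x0 0 = x00 \<and> (\<forall>i. eta i 0 = eta0 i) \<longrightarrow>
              (\<exists>c \<alpha>. \<alpha> > 0 \<and> (\<forall>s\<ge>0. \<forall>i. norm (eta i s - x0 s) \<le> c * exp (- \<alpha> * s))))"
proof -
  have dw: "t (Suc j) - t j \<ge> \<tau>" for j using dwell by blast
  note t_mono = switching_times_strict_mono[OF t0 tau_pos dw]
  note t_gap = switching_times_gap[OF t0 tau_pos dw]
  note t_interval = switching_interval_exists[OF t0 tau_pos dw]
  have t_le: "t i \<le> t j" if "i \<le> j" for i j using t_mono that by (simp add: strict_mono_less_eq)
  have t_nonneg: "0 \<le> t j" for j using t_le[of 0 j] t0 by simp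
  have ug: "undirected_graph (E (\<sigma> s))" if "0 \<le> s" for s
    using E_irrefl undirected that unfolding undirected_graph_def by blast
  have sig: "\<sigma> s = \<sigma> (t j)" if "t j \<le> s" "s < t (Suc j)" for j s using pw_const that by auto
  define P where "P j = Pker (E (\<sigma> (t j)))" for j
  have gapK: "t (jk (k + K)) - t (jk k) \<le> K * Tc" for k K
  proof (induction K)
    case (Suc K)
    then show ?case using jk_gap[rule_format, of "k + K"] by (simp add: algebra_simps)
  qed simp
  \<comment> \<open>Every switching interval lies inside one cycle. This bounds the exponentials
    over single intervals uniformly.\<close>
  have short: "t (Suc j) - t j \<le> Tc" for j
  proof -
    define p where "p = (LEAST p. j < jk p)"
    have "j < jk (Suc j)" using strict_mono_imp_increasing[OF jk_mono, of "Suc j"] by simp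
    then have p: "j < jk p" unfolding p_def by (rule LeastI)
    then have "p \<noteq> 0" using jk0 by (metis not_less0)
    then obtain q where q: "p = Suc q" using not0_implies_Suc by blast
    have "\<not> j < jk q" using not_less_Least[of q "\<lambda>p. j < jk p"] q by (simp add: p_def[symmetric])
    then have "t (jk q) \<le> t j" "t (Suc j) \<le> t (jk (Suc q))" using p q by (auto intro!: t_le)
    then show ?thesis using jk_gap[rule_format, of q] by linarith
  qed

  define \<rho> where "\<rho> = - ln \<delta> / Tc"
  \<comment> \<open>A rate strictly between the spectral bound and \<open>\<rho>\<close>. Taking the
    maximum with 0 keeps \<open>\<mu>\<close> nonnegative, so that exponential bounds are monotone
    in time.\<close>
  define \<mu> where "\<mu> = (max (lambda_max A) 0 + \<rho>) / 2"
  have pos: "0 < \<rho>" unfolding \<rho>_def using delta Tc_pos by (simp add: divide_neg_pos)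
  have \<mu>: "lambda_max A < \<mu>" "0 \<le> \<mu>" "\<mu> < \<rho>"
    using eig[folded \<rho>_def] pos unfolding \<mu>_def by (auto simp: max_def)
  obtain M0 where M0: "\<And>s. s \<ge> 0 \<Longrightarrow> norm (matrix_exp A s) \<le> M0 * exp (\<mu> * s)"
    using matrix_exp_growth[OF \<mu>(1)] by blast
  define M where "M = max M0 1"
  have M1: "1 \<le> M" by (simp add: M_def)
  have M: "norm (matrix_exp A s) \<le> M * exp (\<mu> * r)" if "0 \<le> s" "s \<le> r" for s r
  proof -
    have "norm (matrix_exp A s) \<le> M0 * exp (\<mu> * s)" by (rule M0[OF that(1)])
    also have "\<dots> \<le> M * exp (\<mu> * r)" using that \<mu>(2) by (intro mult_mono) (auto simp: M_def mult_left_mono)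
    finally show ?thesis .
  qed
  \<comment> \<open>The ideal factor per cycle, below 1 because \<open>\<mu> < \<rho>\<close>.
    \<open>K\<close> cycles are grouped so that \<open>q ^ K\<close> also defeats the constant
    \<open>M\<close>.\<close>
  define q where "q = \<delta> * exp (\<mu> * Tc)"
  have "\<mu> * Tc < - ln \<delta>" using \<mu>(3) Tc_pos by (simp add: \<rho>_def field_simps)
  then have "exp (\<mu> * Tc) < exp (- ln \<delta>)" by simp
  then have "q < 1" using delta by (simp add: q_def exp_minus field_simps)
  moreover have "0 < q" using delta by (simp add: q_def)
  ultimately obtain K where K: "q ^ K < 1 / (4 * M)" using real_arch_pow_inv[of "1 / (4 * M)" q] M1 by auto
  have K0: "K > 0"
  proof (rule ccontr)
    assume "\<not> K > 0"
    then have "1 < 1 / (4 * M)" using K by simp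
    then show False using M1 by (simp add: field_simps)
  qed
  have qK: "\<delta> ^ K * (M * exp (\<mu> * (K * Tc))) \<le> 1 / 4"
  proof -
    have "\<delta> ^ K * (M * exp (\<mu> * (K * Tc))) = q ^ K * M"
      by (simp add: q_def power_mult_distrib exp_of_nat_mult[symmetric] mult_ac)
    also have "\<dots> \<le> 1 / (4 * M) * M" using K M1 by (intro mult_right_mono) auto
    finally show ?thesis using M1 by simp
  qed
  define B where "B = M * exp (\<mu> * Tc)"
  have B1: "1 \<le> B" using mult_mono[OF M1, of 1 "exp (\<mu> * Tc)"] \<mu>(2) Tc_pos M1 by (simp add: B_def)
  \<comment> \<open>By the dwell time, at most this many switching intervals fit into
    \<open>K\<close> cycles.\<close>
  define J where "J = nat \<lfloor>K * Tc / \<tau>\<rfloor>"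
  have J: "jk (k + K) - jk k \<le> J" for k
  proof -
    have "jk k \<le> jk (k + K)" using jk_mono by (simp add: strict_mono_less_eq)
    then have "real (jk (k + K) - jk k) * \<tau> \<le> K * Tc" using t_gap[of "jk k" "jk (k + K)"] gapK[of k K] by linarith
    then have "real (jk (k + K) - jk k) \<le> K * Tc / \<tau>" using tau_pos by (simp add: pos_le_divide_eq)
    then show ?thesis unfolding J_def by (rule le_nat_floor)
  qed
  \<comment> \<open>Dominates the accumulated factor \<open>i (B + 1)^i\<close> for all
    \<open>i \<le> J\<close>; the summand 1 keeps \<open>d\<close> at least 1 even for
    \<open>J = 0\<close>. With \<open>\<epsilon> = 1 / (4 d)\<close> the total perturbation over a
    group is at most 1/4.\<close>
  define d where "d = real (J + 1) * (B + 1) ^ J"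
  define \<epsilon> where "\<epsilon> = 1 / (4 * d)"
  have B2: "1 \<le> (B + 1) ^ J" using B1 by (intro one_le_power) simp
  have d: "1 \<le> d" unfolding d_def using mult_mono[OF _ B2, of 1 "real (J + 1)"] by simp
  have \<epsilon>0: "0 < \<epsilon>" and \<epsilon>1: "\<epsilon> \<le> 1" using d by (simp_all add: \<epsilon>_def divide_le_eq)
  have \<epsilon>J: "\<epsilon> * i * (B + 1) ^ i \<le> 1 / 4" if "i \<le> J" for i
  proof -
    have "\<epsilon> * i * (B + 1) ^ i \<le> \<epsilon> * real (J + 1) * (B + 1) ^ J"
      using that \<epsilon>0 B1 by (intro mult_mono power_increasing) auto
    also have "\<dots> = \<epsilon> * d" by (simp add: d_def mult.assoc)
    also have "\<dots> = 1 / 4" using d by (simp add: \<epsilon>_def)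
    finally show ?thesis .
  qed

  obtain L :: "real^'m^'n" where L: "\<And>(G :: ('N option \<times> 'N option) set) (e :: real \<Rightarrow> real^'n^'N) a b.
    undirected_graph G \<Longrightarrow> \<tau> \<le> b - a \<Longrightarrow> continuous_on {a..b} e \<Longrightarrow>
    (\<And>s. a \<le> s \<Longrightarrow> s < b \<Longrightarrow> (e has_vector_derivative
      (e s ** transpose A - Hmat G ** e s ** transpose (L ** C))) (at s within {s..})) \<Longrightarrow>
    norm (e b - Pker G ** e a ** transpose (matrix_exp A (b - a))) \<le> \<epsilon> * norm (e a)"
    using high_gain_exists[OF obs tau_pos \<epsilon>0, where 'N='N] by blast
  define KK where "KK = transpose (L ** C)"
  define FF where "FF G X = X ** transpose A - Hmat G ** X ** KK" for G :: "('N option \<times> 'N option) set" and X :: "real^'n^'N"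
  have FF_linear: "linear (FF G)" for G
    unfolding FF_def
    by (rule linearI) (simp_all add: matrix_add_ldistrib matrix_add_rdistrib matrix_scalar_ac scalar_matrix_assoc[symmetric] scaleR_diff_right)
  \<comment> \<open>Gives one growth rate \<open>\<beta>\<close> for all graphs. It depends on the
    gain already chosen, but it enters only the constant in front of the decay, not the decay
    rate.\<close>
  define h where "h = Max (range (\<lambda>G::('N option \<times> 'N option) set. norm (Hmat G)))"
  have h: "norm (Hmat G) \<le> h" for G :: "('N option \<times> 'N option) set" by (simp add: h_def)
  define \<beta> where "\<beta> = norm A + h * norm KK"
  have h0: "0 \<le> h" using order_trans[OF norm_ge_zero h] .
  have \<beta>: "0 \<le> \<beta>" using h0 by (simp add: \<beta>_def)
  have FF_norm: "norm (FF G X) \<le> \<beta> * norm X" for G X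
  proof -
    have "norm (FF G X) \<le> norm (X ** transpose A) + norm (Hmat G ** X ** KK)"
      unfolding FF_def by (rule norm_triangle_ineq4)
    also have "\<dots> \<le> norm X * norm A + (norm (Hmat G) * norm X) * norm KK"
      by (intro add_mono order_trans[OF norm_matrix_matrix_mult_le] mult_right_mono norm_matrix_matrix_mult_le)
        (simp_all add: norm_transpose)
    also have "\<dots> \<le> norm X * norm A + (h * norm X) * norm KK"
      by (intro add_left_mono mult_right_mono h) auto
    finally show ?thesis by (simp add: \<beta>_def algebra_simps)
  qed

  \<comment> \<open>Stated for an arbitrary solution of the error equation, since the claim concerns
    all solutions and not only the constructed one. The sampling times are the ends of the groups of
    \<open>K\<close> cycles.\<close>
  have decay: "\<exists>c \<alpha>. \<alpha> > 0 \<and> (\<forall>s\<ge>0. norm (e s) \<le> c * exp (- \<alpha> * s))"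
    if cont: "continuous_on {0..} e"
      and der: "\<And>s. 0 \<le> s \<Longrightarrow> (e has_vector_derivative FF (E (\<sigma> s)) (e s)) (at s within {s..})"
    for e :: "real \<Rightarrow> real^'n^'N"
  proof (rule exponential_decay_from_contraction[where T = "\<lambda>p. t (jk (p * K))" and \<Theta> = "K * Tc" and \<beta> = \<beta>])
    show "t (jk (0 * K)) = 0" by (simp add: jk0 t0)
    show "t (jk (Suc p * K)) - t (jk (p * K)) \<le> K * Tc" for p
      using gapK[of "p * K" K] by (simp add: add.commute)
    show "0 < K * Tc" using K0 Tc_pos by simp
    show "\<exists>p. s < t (jk (p * K))" for s
    proof -
      obtain j where "s < t j" using switching_times_unbounded[OF t0 tau_pos dw] by blast
      also have "t j \<le> t (jk (j * K))"
        using K0 strict_mono_imp_increasing[OF jk_mono, of "j * K"] by (intro t_le) (metis le_trans mult_le_mono2 mult_1_right Suc_leI One_nat_def)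
      finally show ?thesis by blast
    qed
    show "norm (e s) \<le> exp (\<beta> * (s - r)) * norm (e r)" if "0 \<le> r" "r \<le> s" for r s
    proof (rule gronwall_right_derivative[OF that(2)])
      show "continuous_on {r..s} e" by (rule continuous_on_subset[OF cont]) (use that in auto)
      show "\<exists>D. (e has_vector_derivative D) (at u within {u..}) \<and> norm D \<le> \<beta> * norm (e u)" if "r \<le> u" for u
        using der[of u] FF_norm \<open>0 \<le> r\<close> that by force
    qed
    show "0 \<le> \<beta>" by (rule \<beta>)
    show "0 \<le> t (jk (p * K))" for p by (rule t_nonneg)
    \<comment> \<open>The factor 1/2 splits evenly: 1/4 for the ideal product over \<open>K\<close>
      cycles and 1/4 for the accumulated deviation from it.\<close>
    show "norm (e (t (jk (Suc p * K)))) \<le> 1 / 2 * norm (e (t (jk (p * K))))" for p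
    proof -
      define a where "a = jk (p * K)"
      define i where "i = jk (p * K + K) - a"
      have ai: "a + i = jk (p * K + K)" using jk_mono by (simp add: i_def a_def strict_mono_less_eq)
      have i: "i \<le> J" using J[of "p * K"] by (simp add: i_def a_def)
      have step: "norm (e (t (Suc j)) - P j ** e (t j) ** transpose (matrix_exp A (t (Suc j) - t j))) \<le> \<epsilon> * norm (e (t j))" for j
        unfolding P_def
      proof (rule L)
        show "undirected_graph (E (\<sigma> (t j)))" by (rule ug[OF t_nonneg])
        show "\<tau> \<le> t (Suc j) - t j" by (rule dw)
        show "continuous_on {t j..t (Suc j)} e"
          by (rule continuous_on_subset[OF cont]) (use t_nonneg[of j] in auto)
        show "(e has_vector_derivative (e s ** transpose A - Hmat (E (\<sigma> (t j))) ** e s ** transpose (L ** C))) (at s within {s..})"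
          if "t j \<le> s" "s < t (Suc j)" for s
          using der[of s] sig[OF that] t_nonneg[of j] that by (simp add: FF_def KK_def)
      qed
      have "norm (e (t (a + i)) - ordprod P a (a + i) ** e (t a) ** transpose (matrix_exp A (t (a + i) - t a)))
          \<le> \<epsilon> * i * (B + 1) ^ i * norm (e (t a))"
      proof (rule perturbed_product_estimate[where e = "\<lambda>j. e (t j)", OF step, THEN conjunct2])
        show "norm (P j ** X) \<le> norm X" for j and X :: "real^'n^'N"
          unfolding P_def by (rule Pker_contraction[OF ug[OF t_nonneg]])
        show "norm (matrix_exp A (t (Suc j) - t j)) \<le> B" for j
          unfolding B_def by (rule M) (use short t_le[of j "Suc j"] in auto)
      qed (use B1 \<epsilon>0 \<epsilon>1 t_le in auto)
      also have "\<dots> \<le> 1 / 4 * norm (e (t a))" by (intro mult_right_mono \<epsilon>J i) auto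
      finally have 1: "norm (e (t (a + i)) - ordprod P a (a + i) ** e (t a) ** transpose (matrix_exp A (t (a + i) - t a))) \<le> 1 / 4 * norm (e (t a))" .
      have "norm (ordprod P a (a + i) ** e (t a) ** transpose (matrix_exp A (t (a + i) - t a)))
          \<le> norm (ordprod P a (a + i) ** e (t a)) * norm (matrix_exp A (t (a + i) - t a))"
        by (metis norm_matrix_matrix_mult_le norm_transpose)
      also have "\<dots> \<le> (\<delta> ^ K * norm (e (t a))) * (M * exp (\<mu> * (K * Tc)))"
      proof (intro mult_mono)
        show "norm (ordprod P a (a + i) ** e (t a)) \<le> \<delta> ^ K * norm (e (t a))"
        proof -
          have "norm (ordprod P (jk (p * K)) (jk (p * K + K)) ** e (t a)) \<le> \<delta> ^ K * norm (e (t a))"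
            using prod_bound delta jk_mono
            by (intro ordprod_cycles_le) (auto simp: P_def[abs_def] strict_mono_mono)
          then show ?thesis unfolding ai by (simp only: a_def)
        qed
        show "norm (matrix_exp A (t (a + i) - t a)) \<le> M * exp (\<mu> * (K * Tc))"
          using t_le[of a "a + i"] gapK[of "p * K" K, folded ai a_def] by (intro M) auto
      qed (use delta in auto)
      also have "\<dots> = (\<delta> ^ K * (M * exp (\<mu> * (K * Tc)))) * norm (e (t a))" by simp
      also have "\<dots> \<le> 1 / 4 * norm (e (t a))" by (intro mult_right_mono qK) auto
      finally have "norm (e (t (a + i))) \<le> 1 / 2 * norm (e (t a))"
        using 1 norm_triangle_sub[of "e (t (a + i))" "ordprod P a (a + i) ** e (t a) ** transpose (matrix_exp A (t (a + i) - t a))"] by linarith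
      then show ?thesis unfolding ai by (simp add: a_def add.commute)
    qed
  qed

  have dyn: "A *v \<eta> i + (L ** C) *v (\<Sum>j\<in>UNIV. adj (E (\<sigma> s)) (Some i) j *\<^sub>R ((case j of None \<Rightarrow> x | Some j' \<Rightarrow> \<eta> j') - \<eta> i))
    = A *v x + FF (E (\<sigma> s)) (\<chi> i. \<eta> i - x) $ i" if "0 \<le> s" for s i x \<eta>
    unfolding FF_def KK_def by (rule error_dynamics[OF ug[OF that]])

  show ?thesis
  proof (intro exI[of _ L] allI conjI impI)
    fix x00 :: "real^'n" and eta0 :: "'N \<Rightarrow> real^'n"
    obtain x0 where x0: "x0 0 = x00" "\<And>s. (x0 has_vector_derivative A *v x0 s) (at s)"
      using linear_ode_exists[OF matrix_vector_mul_linear[of A]] by blast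
    \<comment> \<open>Existence is obtained through the error: its equation is autonomous on each
      interval, and adding the leader's trajectory returns the observer states.\<close>
    obtain e where e: "e 0 = (\<chi> i. eta0 i - x00)" "continuous_on {0..} e"
      "\<And>j s. t j \<le> s \<Longrightarrow> s < t (Suc j) \<Longrightarrow> (e has_vector_derivative FF (E (\<sigma> (t j))) (e s)) (at s within {s..})"
      using switched_linear_ode_exists[OF t0 tau_pos dw, of "\<lambda>j. FF (E (\<sigma> (t j)))"] FF_linear by metis
    have e': "(e has_vector_derivative FF (E (\<sigma> s)) (e s)) (at s within {s..})" if "0 \<le> s" for s
      using t_interval[OF that] e(3) sig by metis
    define eta where "eta i s = x0 s + e s $ i" for i s
    have e_eq: "(\<chi> i. eta i s - x0 s) = e s" for s by (simp add: eta_def vec_eq_iff)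
    have contx: "continuous_on {0..} x0"
      by (rule continuous_on_vector_derivative[OF has_vector_derivative_at_within[OF x0(2)]])
    have "is_solution A (L ** C) (\<lambda>s. E (\<sigma> s)) x0 eta"
      unfolding is_solution_def
    proof (intro conjI allI impI)
      show "continuous_on {0..} (eta i)" for i
        unfolding eta_def by (intro continuous_intros contx e(2))
      show "(x0 has_vector_derivative A *v x0 s) (at s within {s..})" for s
        by (rule has_vector_derivative_at_within[OF x0(2)])
      fix i and s :: real assume s: "0 \<le> s"
      have "((\<lambda>s. x0 s + e s $ i) has_vector_derivative A *v x0 s + FF (E (\<sigma> s)) (e s) $ i) (at s within {s..})"
        by (intro has_vector_derivative_add has_vector_derivative_at_within[OF x0(2)]
          bounded_linear.has_vector_derivative[OF bounded_linear_vec_nth] e' s)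
      then show "(eta i has_vector_derivative
         (A *v eta i s + (L ** C) *v (\<Sum>j\<in>UNIV. adj (E (\<sigma> s)) (Some i) j *\<^sub>R
             ((case j of None \<Rightarrow> x0 s | Some j' \<Rightarrow> eta j' s) - eta i s)))) (at s within {s..})"
        using dyn[OF s, of "\<lambda>i. eta i s" i "x0 s"] by (simp add: e_eq eta_def[abs_def])
    qed (rule contx)
    moreover have "eta i 0 = eta0 i" for i by (simp add: eta_def e(1) x0(1))
    ultimately show "\<exists>x0 eta. is_solution A (L ** C) (\<lambda>s. E (\<sigma> s)) x0 eta \<and> x0 0 = x00 \<and> (\<forall>i. eta i 0 = eta0 i)"
      using x0(1) by blast
  next
    fix x00 :: "real^'n" and eta0 :: "'N \<Rightarrow> real^'n" and x0 eta
    assume "is_solution A (L ** C) (\<lambda>s. E (\<sigma> s)) x0 eta \<and> x0 0 = x00 \<and> (\<forall>i. eta i 0 = eta0 i)"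
    then have sol: "is_solution A (L ** C) (\<lambda>s. E (\<sigma> s)) x0 eta" by blast
    define e where "e s = (\<chi> i. eta i s - x0 s)" for s
    have "\<exists>c \<alpha>. \<alpha> > 0 \<and> (\<forall>s\<ge>0. norm (e s) \<le> c * exp (- \<alpha> * s))"
    proof (rule decay)
      show "continuous_on {0..} e"
        unfolding e_def using sol by (intro continuous_on_vec_lambda continuous_intros) (auto simp: is_solution_def)
      fix s :: real assume s: "0 \<le> s"
      have "(eta i has_vector_derivative A *v x0 s + FF (E (\<sigma> s)) (e s) $ i) (at s within {s..})" for i
        unfolding e_def dyn[OF s, of "\<lambda>i. eta i s" i "x0 s", symmetric]
        using sol s unfolding is_solution_def by blast
      moreover have "(x0 has_vector_derivative A *v x0 s) (at s within {s..})"
        using sol s by (simp add: is_solution_def)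
      ultimately have "((\<lambda>s. eta i s - x0 s) has_vector_derivative FF (E (\<sigma> s)) (e s) $ i) (at s within {s..})" for i
        using has_vector_derivative_diff by fastforce
      from has_vector_derivative_vec_lambda[where f = "\<lambda>i s. eta i s - x0 s" and f' = "\<lambda>i. FF (E (\<sigma> s)) (e s) $ i", OF this]
      show "(e has_vector_derivative FF (E (\<sigma> s)) (e s)) (at s within {s..})"
        by (simp add: e_def[abs_def])
    qed
    then obtain c \<alpha> where "\<alpha> > 0" and c: "\<And>s. s \<ge> 0 \<Longrightarrow> norm (e s) \<le> c * exp (- \<alpha> * s)" by blast
    moreover have "norm (eta i s - x0 s) \<le> norm (e s)" for i s
      using Finite_Cartesian_Product.norm_nth_le[of "e s" i] by (simp add: e_def)
    ultimately show "\<exists>c \<alpha>. \<alpha> > 0 \<and> (\<forall>s\<ge>0. \<forall>i. norm (eta i s - x0 s) \<le> c * exp (- \<alpha> * s))"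
      by (meson order_trans)
  qed
qed

end
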